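(* Let $P_0$ be a probability measure on a measurable space $\mathcal X$, $T\ge2$ an integer, and $h:\mathcal X^T\to\mathbb R$ measurable. Assume there are functions $\Lambda_1,\dots,\Lambda_T:\mathcal X\to\mathbb R$ with $|h(x_1,\dots,x_T)|\le\sum_{t=1}^T\Lambda_t(x_t)$, such that for each $t$, $E_0[e^{\theta\Lambda_t(X)}]<\infty$ for all $\theta$ in a neighborhood of $0$. Put $\Lambda(x)=\sum_{t=1}^T\Lambda_t(x)$ and fix a constant $M>E_0[\Lambda(X)]$ and $\eta>0$. Then for all sufficiently large $\alpha>0$, the problem $$\max_{L\in\mathcal L(M)}\ E_0\Big[h(\mathbf X_T)\prod_{t=1}^TL(X_t)\Big]-\alpha\big(E_0[L(X)\log L(X)]-\eta\big)$$ has a unique optimal solution, and this solution $L$ satisfies $$L(x)=\frac{e^{g^L(x)/\alpha}}{E_0[e^{g^L(X)/\alpha}]},$$ where $g^L(x)=\sum_{t=1}^Tg_t^L(x)$ and $g_t^L(x)=E_0\Big[h(\mathbf X_T)\prod_{1\le r\le T,\ r\ne t}L(X_r)\,\Big|\,X_t=x\Big]$.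
   Context: $\mathbf X_T=(X_1,\dots,X_T)$, and under $E_0$ the variables $X,X_1,\dots,X_T$ are i.i.d. with distribution $P_0$. $\mathcal L=\{L\in\mathcal L_1(P_0):E_0[L(X)]=1,\ L\ge0\text{ a.s.}\}$ is the set of likelihood ratios (elements identified $P_0$-a.s.), and $\mathcal L(M)=\{L\in\mathcal L:E_0[\Lambda(X)L(X)]\le M\}$. The convention $0\log0=0$ is used, and $E_0[L\log L]$ may equal $+\infty$. *)

theory Defs
  imports "HOL-Probability.Probability"
begin

text \<open>Expectation with values in the extended reals; it is the usual one whenever the positive
  or the negative part of the integrand has a finite integral. Below it is applied only to
  \<open>L log L\<close>, which is a.s. bounded below by \<open>-1/e\<close>, and to a.s. nonnegative functions.\<close>

definition ext_expectation :: "'a measure \<Rightarrow> ('a \<Rightarrow> real) \<Rightarrow> ereal" where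
  "ext_expectation P f =
     enn2ereal (\<integral>\<^sup>+x. ennreal (f x) \<partial>P) - enn2ereal (\<integral>\<^sup>+x. ennreal (- f x) \<partial>P)"

text \<open>\<open>E[Y | X = x]\<close> as a function of \<open>x\<close>: a measurable \<open>g\<close> such that \<open>g(X)\<close> is a version of the
  conditional expectation of \<open>Y\<close> given the sigma-algebra generated by \<open>X\<close>. Such a \<open>g\<close> is determined
  only up to null sets of the distribution of \<open>X\<close>.\<close>

definition cond_exp_given :: "'w measure \<Rightarrow> 'a measure \<Rightarrow> ('w \<Rightarrow> 'a) \<Rightarrow> ('w \<Rightarrow> real) \<Rightarrow> 'a \<Rightarrow> real" where
  "cond_exp_given W S X Y =
     (SOME g. g \<in> borel_measurable S \<and>
        (AE w in W. g (X w) = real_cond_exp W (vimage_algebra (space W) X S) Y w))"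

text \<open>Likelihood ratios are represented by functions; a.s. equal functions stand for the same
  likelihood ratio.\<close>

definition likelihood_ratios :: "'a measure \<Rightarrow> ('a \<Rightarrow> real) set" where
  "likelihood_ratios P =
     {L. integrable P L \<and> (\<integral>x. L x \<partial>P) = 1 \<and> (AE x in P. 0 \<le> L x)}"

definition likelihood_ratios_bounded ::
    "'a measure \<Rightarrow> ('a \<Rightarrow> real) \<Rightarrow> real \<Rightarrow> ('a \<Rightarrow> real) set" where
  "likelihood_ratios_bounded P \<Lambda> M =
     {L \<in> likelihood_ratios P. ext_expectation P (\<lambda>x. \<Lambda> x * L x) \<le> ereal M}"

text \<open>\<open>X\<^sub>1, \<dots>, X\<^sub>T\<close> are realized as the coordinates of the product space.\<close>

abbreviation iid_space :: "'a measure \<Rightarrow> nat \<Rightarrow> (nat \<Rightarrow> 'a) measure" where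
  "iid_space P T \<equiv> \<Pi>\<^sub>M t\<in>{1..T}. P"

text \<open>The integrand \<open>L x * ln (L x)\<close> is \<open>0\<close> where \<open>L x = 0\<close>.\<close>

definition penalized_objective ::
    "'a measure \<Rightarrow> nat \<Rightarrow> ((nat \<Rightarrow> 'a) \<Rightarrow> real) \<Rightarrow> real \<Rightarrow> real \<Rightarrow> ('a \<Rightarrow> real) \<Rightarrow> ereal" where
  "penalized_objective P T h \<eta> \<alpha> L =
     ereal (\<integral>x. h x * (\<Prod>t=1..T. L (x t)) \<partial>iid_space P T)
       - ereal \<alpha> * (ext_expectation P (\<lambda>x. L x * ln (L x)) - ereal \<eta>)"

definition g_component ::
    "'a measure \<Rightarrow> nat \<Rightarrow> ((nat \<Rightarrow> 'a) \<Rightarrow> real) \<Rightarrow> ('a \<Rightarrow> real) \<Rightarrow> nat \<Rightarrow> 'a \<Rightarrow> real" where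
  "g_component P T h L t =
     cond_exp_given (iid_space P T) P (\<lambda>x. x t) (\<lambda>x. h x * (\<Prod>r\<in>{1..T} - {t}. L (x r)))"

definition g_total ::
    "'a measure \<Rightarrow> nat \<Rightarrow> ((nat \<Rightarrow> 'a) \<Rightarrow> real) \<Rightarrow> ('a \<Rightarrow> real) \<Rightarrow> 'a \<Rightarrow> real" where
  "g_total P T h L x = (\<Sum>t=1..T. g_component P T h L t x)"

end

theory Submission
  imports Defs
begin

text \<open>
  Writing \<open>V = 1 + \<Lambda>\<close>, the hypothesis on \<open>h\<close> gives \<open>\<bar>h x\<bar> \<le> V (x 1) * \<dots> * V (x T)\<close>, so
  \<open>E[h \<Prod>L]\<close> is a bounded multilinear form in \<open>L\<close> for the weighted norm
  \<open>\<parallel>L\<parallel> = E[V \<bar>L\<bar>]\<close>. On the feasible set this norm is \<open>1 + E[\<Lambda> L]\<close>, hence at most \<open>B = 1 + M\<close>: the moment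
  constraint is exactly a bound on the norm. The exponential moments of the \<open>\<Lambda>\<^sub>c t\<close> are inherited by \<open>V\<close>.

  First, for large \<open>\<alpha>\<close> there is a density \<open>q\<close> with \<open>q = exp (g\<^sup>q / \<alpha>) / E[exp (g\<^sup>q / \<alpha>)]\<close>
  (\<open>gibbs_fixed_point\<close>). The gradient \<open>g\<^sup>q\<close> is at most a constant times \<open>V\<close>, so \<open>g\<^sup>q / \<alpha>\<close> is \<open>w V\<close> with
  \<open>w\<close> uniformly of size \<open>O(1/\<alpha>)\<close>. Densities \<open>exp (w V) / E[exp (w V)]\<close> with small \<open>w\<close> are close to \<open>1\<close>
  and therefore satisfy the strict inequality \<open>E[\<Lambda>] < M\<close> with room to spare (\<open>gibbs_wnorm_le\<close>), and they depend
  on \<open>w\<close> in a Lipschitz way (\<open>gibbs_lipschitz\<close>); so \<open>u \<mapsto> g\<^sup>q / V\<close>, where \<open>q\<close> is built from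
  \<open>w = u / \<alpha>\<close>, contracts the supremum norm.

  Secondly, such a \<open>q\<close> beats every other feasible \<open>p\<close> (\<open>functional_gap\<close>). Because \<open>g\<^sup>q\<close> is \<open>\<alpha>\<close> times the
  logarithm of \<open>q\<close> up to a constant, the first-order terms of the functional at \<open>q\<close> cancel, and the objective
  at \<open>p\<close> minus the objective at \<open>q\<close> is the second-order remainder of the multilinear form minus
  \<open>\<alpha>\<close> times the relative entropy of \<open>p\<close> with respect to \<open>q\<close>. The remainder is at most
  \<open>C \<parallel>p - q\<parallel>\<^sup>2\<close> (\<open>linear_remainder_bound\<close>), while a weighted Pinsker inequality bounds the
  relative entropy below by \<open>c \<parallel>p - q\<parallel>\<^sup>2\<close> (\<open>entropy_strongly_convex_at_gibbs\<close>), with \<open>C\<close> and \<open>c > 0\<close>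
  not depending on \<open>\<alpha>\<close>. For \<open>\<alpha> c > C\<close> the difference is negative unless \<open>p = q\<close>
  almost surely. This gives existence, uniqueness and the formula at once; the conditional expectations that
  define \<open>g\<close> are identified with partial integrals by Fubini (\<open>g_component_eq_partial_derivative\<close>).
\<close>

section \<open>Products and powers near a point\<close>

text \<open>Expanding both sides over subsets of \<open>I\<close>, the left-hand side is a sum of mixed terms in \<open>a - b\<close> and \<open>b\<close>,
  and the right-hand side is the sum of their absolute values. The right-hand side is again a difference
  of products, so it integrates coordinate by coordinate.\<close>

lemma prod_diff_le:
  fixes a b :: "'i \<Rightarrow> real"
  assumes "finite I" "\<And>i. i \<in> I \<Longrightarrow> 0 \<le> b i"
  shows "\<bar>(\<Prod>i\<in>I. a i) - (\<Prod>i\<in>I. b i)\<bar> \<le> (\<Prod>i\<in>I. b i + \<bar>a i - b i\<bar>) - (\<Prod>i\<in>I. b i)"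
  using assms
proof (induction I rule: finite_induct)
  case (insert i I)
  let ?A = "\<Prod>i\<in>I. a i" and ?B = "\<Prod>i\<in>I. b i" and ?Q = "\<Prod>i\<in>I. b i + \<bar>a i - b i\<bar>"
  have bi: "0 \<le> b i" using insert by auto
  have IH: "\<bar>?A - ?B\<bar> \<le> ?Q - ?B" using insert by auto
  have B: "0 \<le> ?B" by (rule prod_nonneg) (use insert in auto)
  have "\<bar>a i * ?A - b i * ?B\<bar> = \<bar>a i * (?A - ?B) + (a i - b i) * ?B\<bar>"
    by (simp add: algebra_simps)
  also have "\<dots> \<le> \<bar>a i\<bar> * \<bar>?A - ?B\<bar> + \<bar>a i - b i\<bar> * ?B"
    using B by (intro order_trans[OF abs_triangle_ineq]) (simp add: abs_mult)
  also have "\<dots> \<le> (b i + \<bar>a i - b i\<bar>) * (?Q - ?B) + \<bar>a i - b i\<bar> * ?B"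
    using IH bi B by (intro add_mono mult_mono) auto
  also have "\<dots> = (b i + \<bar>a i - b i\<bar>) * ?Q - b i * ?B" by (simp add: algebra_simps)
  finally show ?case using insert by simp
qed auto

text \<open>The same comparison of expansions, without the terms of degree at most one in \<open>a - b\<close>.\<close>

lemma prod_diff_linear_le:
  fixes a b :: "'i \<Rightarrow> real"
  assumes "finite I" "\<And>i. i \<in> I \<Longrightarrow> 0 \<le> b i"
  shows "\<bar>(\<Prod>i\<in>I. a i) - (\<Prod>i\<in>I. b i) - (\<Sum>i\<in>I. (a i - b i) * (\<Prod>j\<in>I - {i}. b j))\<bar>
    \<le> (\<Prod>i\<in>I. b i + \<bar>a i - b i\<bar>) - (\<Prod>i\<in>I. b i) - (\<Sum>i\<in>I. \<bar>a i - b i\<bar> * (\<Prod>j\<in>I - {i}. b j))"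
  using assms
proof (induction I rule: finite_induct)
  case (insert i I)
  let ?A = "\<Prod>i\<in>I. a i" and ?B = "\<Prod>i\<in>I. b i" and ?Q = "\<Prod>i\<in>I. b i + \<bar>a i - b i\<bar>"
  let ?L = "\<lambda>d I. \<Sum>i\<in>I. d i * (\<Prod>j\<in>I - {i}. b j)"
  have bi: "0 \<le> b i" using insert by auto
  have L: "?L d (insert i I) = d i * ?B + b i * ?L d I" for d :: "'i \<Rightarrow> real"
  proof -
    have "(\<Prod>j\<in>insert i I - {k}. b j) = b i * (\<Prod>j\<in>I - {k}. b j)" if "k \<in> I" for k
    proof -
      have "insert i I - {k} = insert i (I - {k})" using that insert by auto
      then show ?thesis using insert by simp
    qed
    then have "(\<Sum>k\<in>I. d k * (\<Prod>j\<in>insert i I - {k}. b j)) = b i * ?L d I"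
      by (simp add: sum_distrib_left mult_ac)
    then show ?thesis using insert by simp
  qed
  have IH: "\<bar>?A - ?B - ?L (\<lambda>i. a i - b i) I\<bar> \<le> ?Q - ?B - ?L (\<lambda>i. \<bar>a i - b i\<bar>) I"
    using insert by auto
  have first: "\<bar>?A - ?B\<bar> \<le> ?Q - ?B" using insert by (intro prod_diff_le) auto
  have "\<bar>a i * ?A - b i * ?B - ?L (\<lambda>i. a i - b i) (insert i I)\<bar>
      = \<bar>b i * (?A - ?B - ?L (\<lambda>i. a i - b i) I) + (a i - b i) * (?A - ?B)\<bar>"
    unfolding L by (simp add: algebra_simps)
  also have "\<dots> \<le> b i * \<bar>?A - ?B - ?L (\<lambda>i. a i - b i) I\<bar> + \<bar>a i - b i\<bar> * \<bar>?A - ?B\<bar>"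
    using bi by (intro order_trans[OF abs_triangle_ineq]) (simp add: abs_mult)
  also have "\<dots> \<le> b i * (?Q - ?B - ?L (\<lambda>i. \<bar>a i - b i\<bar>) I) + \<bar>a i - b i\<bar> * (?Q - ?B)"
    using IH first bi by (intro add_mono mult_left_mono) auto
  also have "\<dots> = (b i + \<bar>a i - b i\<bar>) * ?Q - b i * ?B - ?L (\<lambda>i. \<bar>a i - b i\<bar>) (insert i I)"
    unfolding L by (simp add: algebra_simps)
  finally show ?case using insert by simp
qed auto

text \<open>The powers of \<open>c \<ge> 1\<close> on the right are larger than necessary; this avoids truncated exponents
  such as \<open>n - 2\<close>.\<close>

lemma power_diff_le:
  fixes b d c :: real
  assumes "0 \<le> b" "0 \<le> d" "b + d \<le> c" "1 \<le> c"
  shows "(b + d) ^ n - b ^ n \<le> real n * d * c ^ n"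
proof (induction n)
  case (Suc n)
  have "(b + d) ^ Suc n - b ^ Suc n = b * ((b + d) ^ n - b ^ n) + d * (b + d) ^ n"
    by (simp add: algebra_simps)
  also have "\<dots> \<le> c * (real n * d * c ^ n) + d * c ^ Suc n"
  proof (intro add_mono mult_left_mono mult_mono)
    have "(b + d) ^ n \<le> c ^ n" using assms by (intro power_mono) auto
    also have "\<dots> \<le> c ^ Suc n" using assms by (intro power_increasing) auto
    finally show "(b + d) ^ n \<le> c ^ Suc n" .
  qed (use assms Suc in \<open>auto intro: power_mono\<close>)
  finally show ?case by (simp add: algebra_simps)
qed simp

lemma power_diff_linear_le:
  fixes b d c :: real
  assumes "0 \<le> b" "0 \<le> d" "b + d \<le> c" "1 \<le> c"
  shows "(b + d) ^ n - b ^ n - real n * (d * b ^ (n - 1)) \<le> (real n)\<^sup>2 * d\<^sup>2 * c ^ n"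
proof (induction n)
  case (Suc n)
  have *: "real n * (b * (d * b ^ (n - 1))) = real n * (d * b ^ n)"
    by (cases n) auto
  have "(b + d) ^ Suc n - b ^ Suc n - real (Suc n) * (d * b ^ (Suc n - 1))
      = b * ((b + d) ^ n - b ^ n - real n * (d * b ^ (n - 1))) + d * ((b + d) ^ n - b ^ n)"
    using * by (simp add: algebra_simps)
  also have "\<dots> \<le> c * ((real n)\<^sup>2 * d\<^sup>2 * c ^ n) + d * (real n * d * c ^ Suc n)"
  proof (intro add_mono mult_left_mono)
    have "b * ((b + d) ^ n - b ^ n - real n * (d * b ^ (n - 1))) \<le> b * ((real n)\<^sup>2 * d\<^sup>2 * c ^ n)"
      using assms Suc by (intro mult_left_mono) auto
    also have "\<dots> \<le> c * ((real n)\<^sup>2 * d\<^sup>2 * c ^ n)" using assms by (intro mult_right_mono) auto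
    finally show "b * ((b + d) ^ n - b ^ n - real n * (d * b ^ (n - 1))) \<le> c * ((real n)\<^sup>2 * d\<^sup>2 * c ^ n)" .
    have "(b + d) ^ n - b ^ n \<le> real n * d * c ^ n" using assms by (intro power_diff_le)
    also have "\<dots> \<le> real n * d * c ^ Suc n"
      using assms by (intro mult_left_mono power_increasing) auto
    finally show "(b + d) ^ n - b ^ n \<le> real n * d * c ^ Suc n" .
  qed (use assms in auto)
  also have "\<dots> = ((real n)\<^sup>2 + real n) * (d\<^sup>2 * c ^ Suc n)" by (simp add: algebra_simps power2_eq_square)
  also have "\<dots> \<le> (real (Suc n))\<^sup>2 * (d\<^sup>2 * c ^ Suc n)"
    using assms by (intro mult_right_mono) (auto simp: power2_eq_square algebra_simps)
  finally show ?case by (simp add: algebra_simps)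
qed simp

section \<open>Fixed points of contractions in the supremum norm\<close>

text \<open>Banach iteration carried out pointwise, so that a class of functions closed under pointwise limits (here:
  bounded measurable functions) needs no metric structure of its own. The distance between the \<open>n\<close>-th iterates from
  two starting points is at most \<open>2 R / 2 ^ n\<close>; comparing the starting points \<open>u0\<close> and
  \<open>(\<Phi> ^^ k) u0\<close> shows that the iterates form a Cauchy sequence.\<close>

lemma sup_contraction_fixed_point:
  fixes \<Phi> :: "('a \<Rightarrow> real) \<Rightarrow> 'a \<Rightarrow> real"
  assumes u0: "u0 \<in> S"
    and maps: "\<And>u. u \<in> S \<Longrightarrow> \<Phi> u \<in> S"
    and bounded: "\<And>u x. u \<in> S \<Longrightarrow> x \<in> \<Omega> \<Longrightarrow> \<bar>u x\<bar> \<le> R"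
    and contr: "\<And>u v q x. u \<in> S \<Longrightarrow> v \<in> S \<Longrightarrow> (\<And>y. y \<in> \<Omega> \<Longrightarrow> \<bar>u y - v y\<bar> \<le> q) \<Longrightarrow> x \<in> \<Omega>
        \<Longrightarrow> \<bar>\<Phi> u x - \<Phi> v x\<bar> \<le> q / 2"
    and closed: "\<And>f u. (\<And>n. f n \<in> S) \<Longrightarrow> (\<And>x. x \<in> \<Omega> \<Longrightarrow> (\<lambda>n. f n x) \<longlonglongrightarrow> u x) \<Longrightarrow> u \<in> S"
  shows "\<exists>u\<in>S. \<forall>x\<in>\<Omega>. \<Phi> u x = u x"
proof -
  define f where "f n = (\<Phi> ^^ n) u0" for n
  define u where "u x = lim (\<lambda>n. f n x)" for x
  have iter: "(\<Phi> ^^ n) v \<in> S" if "v \<in> S" for n v using that maps by (induction n) auto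
  have close: "\<bar>(\<Phi> ^^ n) v x - (\<Phi> ^^ n) w x\<bar> \<le> 2 * R / 2 ^ n" if "v \<in> S" "w \<in> S" "x \<in> \<Omega>" for n v w x
    using that(3)
  proof (induction n arbitrary: x)
    case 0
    then show ?case using bounded[OF that(1) 0] bounded[OF that(2) 0] by simp
  next
    case (Suc n)
    show ?case using contr[OF iter[OF that(1)] iter[OF that(2)] Suc.IH Suc.prems] by simp
  qed
  have tail: "\<bar>f n x - f m x\<bar> \<le> 2 * R / 2 ^ n" if "x \<in> \<Omega>" "n \<le> m" for n m x
  proof -
    have "f m = (\<Phi> ^^ n) ((\<Phi> ^^ (m - n)) u0)"
      using funpow_add[of n "m - n" \<Phi>] that by (simp add: f_def)
    then show ?thesis using close[OF u0 iter[OF u0] that(1)] by (simp add: f_def)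
  qed
  have lim0: "(\<lambda>n. 2 * R / 2 ^ n) \<longlonglongrightarrow> 0"
    using LIMSEQ_inverse_realpow_zero[of 2] tendsto_mult[OF tendsto_const[of "2 * R"]]
    by (fastforce simp: divide_inverse)
  have conv: "(\<lambda>n. f n x) \<longlonglongrightarrow> u x" if "x \<in> \<Omega>" for x
  proof -
    have "Cauchy (\<lambda>n. f n x)"
    proof (rule CauchyI)
      fix e :: real assume "0 < e"
      then have "eventually (\<lambda>n. 2 * R / 2 ^ n < e / 2) sequentially"
        using lim0 by (intro order_tendstoD) auto
      then obtain N where N: "2 * R / 2 ^ N < e / 2" by (auto simp: eventually_sequentially)
      show "\<exists>K. \<forall>m\<ge>K. \<forall>n\<ge>K. norm (f m x - f n x) < e"
      proof (intro exI allI impI)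
        fix m n assume "N \<le> m" "N \<le> n"
        then show "norm (f m x - f n x) < e"
          using tail[OF that \<open>N \<le> m\<close>] tail[OF that \<open>N \<le> n\<close>] N by (simp add: abs_le_iff abs_less_iff)
      qed
    qed
    then show ?thesis by (simp add: u_def Cauchy_convergent_iff convergent_LIMSEQ_iff)
  qed
  have uS: "u \<in> S"
  proof (rule closed)
    show "f n \<in> S" for n using iter[OF u0] by (simp add: f_def)
  qed (rule conv)
  have dist: "\<bar>u x - f n x\<bar> \<le> 2 * R / 2 ^ n" if "x \<in> \<Omega>" for x n
  proof (rule tendsto_upperbound)
    show "(\<lambda>m. \<bar>f m x - f n x\<bar>) \<longlonglongrightarrow> \<bar>u x - f n x\<bar>" using conv[OF that] by (intro tendsto_intros)
    show "\<forall>\<^sub>F m in sequentially. \<bar>f m x - f n x\<bar> \<le> 2 * R / 2 ^ n"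
      using tail[OF that, of n] unfolding eventually_sequentially
      by (auto intro!: exI[of _ n] simp: abs_minus_commute)
  qed simp
  have "\<Phi> u x = u x" if x: "x \<in> \<Omega>" for x
  proof (rule LIMSEQ_unique)
    show "(\<lambda>n. f (Suc n) x) \<longlonglongrightarrow> u x" using conv[OF x] by (rule LIMSEQ_Suc)
    have "\<bar>f (Suc n) x - \<Phi> u x\<bar> \<le> 2 * R / 2 ^ n" for n
    proof -
      have "f n \<in> S" using iter[OF u0] by (simp add: f_def)
      from contr[OF uS this dist[of _ n] x] 
      have "\<bar>\<Phi> u x - f (Suc n) x\<bar> \<le> 2 * R / 2 ^ n / 2" by (simp add: f_def)
      moreover have "0 \<le> 2 * R / 2 ^ n" using dist[OF x, of n] abs_ge_zero order_trans by blast
      moreover define e where "e = 2 * R / 2 ^ n"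
      ultimately show ?thesis unfolding e_def[symmetric] by (subst abs_minus_commute) linarith
    qed
    then have "(\<lambda>n. f (Suc n) x - \<Phi> u x) \<longlonglongrightarrow> 0"
      by (intro Lim_null_comparison[OF _ lim0]) auto
    then show "(\<lambda>n. f (Suc n) x) \<longlonglongrightarrow> \<Phi> u x" by (rule LIM_zero_cancel)
  qed
  then show ?thesis using uS by blast
qed

section \<open>Young inequality for the relative entropy\<close>

text \<open>Compare the power series term by term: each term of order \<open>k \<ge> 2\<close> contains \<open>c ^ k\<close>, which is
  at most \<open>c\<^sup>2\<close> in absolute value.\<close>

lemma exp_second_order_le:
  fixes c u :: real
  assumes "\<bar>c\<bar> \<le> 1" "0 \<le> u"
  shows "exp (c * u) - 1 - c * u \<le> c\<^sup>2 * exp u"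
proof -
  have s: "(\<lambda>n. x ^ (n + 2) /\<^sub>R fact (n + 2)) sums (exp x - 1 - x)" for x :: real
    using sums_split_initial_segment[OF exp_converges[of x], of 2] by (simp add: eval_nat_numeral algebra_simps)
  have "exp (c * u) - 1 - c * u \<le> c\<^sup>2 * (exp u - 1 - u)"
  proof (rule sums_le[OF _ s sums_mult[OF s]])
    fix n :: nat
    define k :: nat where "k = n + 2"
    have "(c * u) ^ k \<le> \<bar>c\<bar> ^ k * u ^ k"
      using abs_ge_self[of "(c * u) ^ k"] assms by (simp add: power_mult_distrib abs_mult power_abs)
    also have "\<dots> \<le> \<bar>c\<bar> ^ 2 * u ^ k"
      using assms by (intro mult_right_mono power_decreasing) (auto simp: k_def)
    finally have "inverse (fact k) * (c * u) ^ k \<le> inverse (fact k) * (c\<^sup>2 * u ^ k)"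
      by (intro mult_left_mono) auto
    then show "(c * u) ^ (n + 2) /\<^sub>R fact (n + 2) \<le> c\<^sup>2 * (u ^ (n + 2) /\<^sub>R fact (n + 2))"
      unfolding k_def[symmetric] by (simp add: mult_ac)
  qed
  also have "\<dots> \<le> c\<^sup>2 * exp u" using assms by (intro mult_left_mono) auto
  finally show ?thesis .
qed

text \<open>Convex duality between \<open>r ln r - r + 1\<close> and \<open>exp s - 1\<close>, evaluated at the density ratio \<open>r = p / q\<close> and
  multiplied by \<open>q\<close>.\<close>

lemma relative_entropy_Young:
  fixes p q s :: real
  assumes "0 \<le> p" "0 < q"
  shows "s * (p - q) \<le> p * ln p - p * ln q - p + q + q * (exp s - 1 - s)"
proof (cases "p = 0")
  case False
  then have p: "0 < p" using assms by simp
  have "ln (q * exp s / p) \<le> q * exp s / p - 1"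
    using p assms by (intro ln_le_minus_one) auto
  then have "p * (ln q + s - ln p) \<le> p * (q * exp s / p - 1)"
    using p assms by (intro mult_left_mono) (auto simp: ln_div ln_mult)
  also have "\<dots> = q * exp s - p" using p by (simp add: field_simps)
  finally show ?thesis by (simp add: algebra_simps)
next
  case True
  show ?thesis using assms True by (simp add: algebra_simps)
qed

text \<open>The parameter \<open>c\<close> is free in \<open>[0, 1]\<close>. The left-hand side is of first order in \<open>c\<close> and the last term on the
  right is of second order, so optimising over \<open>c\<close> after integration turns a bound on \<open>\<bar>p - q\<bar>\<close> into a
  quadratic one, although \<open>u\<close> is only assumed to have exponential (not Gaussian) moments.\<close>

lemma weighted_relative_entropy_Young:
  fixes p q u c :: real
  assumes "0 \<le> p" "0 < q" "0 \<le> u" "0 \<le> c" "c \<le> 1"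
  shows "c * u * \<bar>p - q\<bar> \<le> p * ln p - p * ln q - p + q + c\<^sup>2 * (q * exp u)"
proof -
  define \<sigma> :: real where "\<sigma> = (if q \<le> p then c else - c)"
  have "c * u * \<bar>p - q\<bar> = (\<sigma> * u) * (p - q)" by (auto simp: \<sigma>_def abs_if algebra_simps)
  also have "\<dots> \<le> p * ln p - p * ln q - p + q + q * (exp (\<sigma> * u) - 1 - \<sigma> * u)"
    using assms by (intro relative_entropy_Young)
  also have "q * (exp (\<sigma> * u) - 1 - \<sigma> * u) \<le> q * (\<sigma>\<^sup>2 * exp u)"
    using assms by (intro mult_left_mono exp_second_order_le) (auto simp: \<sigma>_def)
  also have "\<sigma>\<^sup>2 = c\<^sup>2" by (simp add: \<sigma>_def)
  finally show ?thesis by (simp add: mult_ac)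
qed

section \<open>Exponentials and quotients\<close>

lemma exp_diff_le:
  fixes a b c :: real
  assumes "a \<le> c" "b \<le> c"
  shows "\<bar>exp a - exp b\<bar> \<le> \<bar>a - b\<bar> * exp c"
proof -
  have *: "exp x - exp y \<le> (x - y) * exp x" for x y :: real
  proof -
    have "exp x * (1 + (y - x)) \<le> exp x * exp (y - x)"
      by (intro mult_left_mono exp_ge_add_one_self) auto
    then show ?thesis by (simp add: algebra_simps flip: exp_add)
  qed
  have "exp x - exp y \<le> \<bar>a - b\<bar> * exp c" if "x \<le> c" "\<bar>x - y\<bar> = \<bar>a - b\<bar>" for x y
  proof -
    have "(x - y) * exp x \<le> \<bar>x - y\<bar> * exp c" using that by (intro mult_mono) auto
    then show ?thesis using *[of x y] that by simp
  qed
  from this[of a b] this[of b a] show ?thesis using assms by (auto simp: abs_le_iff abs_minus_commute)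
qed

lemma quotient_diff_le:
  fixes a b c d :: real
  assumes "0 < c" "0 < d" "0 \<le> b"
  shows "\<bar>a / c - b / d\<bar> \<le> \<bar>a - b\<bar> / c + b * (\<bar>d - c\<bar> / (c * d))"
proof -
  have "a / c - b / d = (a - b) / c + b * ((d - c) / (c * d))"
    using assms by (simp add: field_simps)
  then have "\<bar>a / c - b / d\<bar> \<le> \<bar>(a - b) / c\<bar> + \<bar>b * ((d - c) / (c * d))\<bar>"
    by (simp only: abs_triangle_ineq)
  also have "\<dots> = \<bar>a - b\<bar> / c + b * (\<bar>d - c\<bar> / (c * d))"
    using assms by (simp only: abs_mult abs_divide abs_of_pos abs_of_nonneg)
  finally show ?thesis .
qed

section \<open>Kernels dominated by a product of weights\<close>

text \<open>The abstract setting. Multiplying densities by \<open>V\<close> turns \<open>h\<close> into a kernel bounded by one, and the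
  exponential moment makes expectations of \<open>V\<close> under small exponential tilts finite.\<close>

locale weighted_kernel = prob_space P for P :: "'a measure" +
  fixes T :: nat and h :: "(nat \<Rightarrow> 'a) \<Rightarrow> real" and V :: "'a \<Rightarrow> real" and \<theta> :: real
  assumes T_ge2: "2 \<le> T"
    and h_measurable [measurable]: "h \<in> borel_measurable (iid_space P T)"
    and V_measurable [measurable]: "V \<in> borel_measurable P"
    and V_ge1: "\<And>x. x \<in> space P \<Longrightarrow> 1 \<le> V x"
    and h_le_prod: "\<And>x. x \<in> space (iid_space P T) \<Longrightarrow> \<bar>h x\<bar> \<le> (\<Prod>t=1..T. V (x t))"
    and \<theta>_pos: "0 < \<theta>"
    and exp_moment: "integrable P (\<lambda>x. exp (2 * \<theta> * V x))"
begin

sublocale coords: product_sigma_finite "\<lambda>_::nat. P" ..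

definition weighted :: "('a \<Rightarrow> real) \<Rightarrow> bool" where
  "weighted p \<longleftrightarrow> p \<in> borel_measurable P \<and> integrable P (\<lambda>x. V x * p x)"

abbreviation wnorm :: "('a \<Rightarrow> real) \<Rightarrow> real" where
  "wnorm p \<equiv> \<integral>x. V x * \<bar>p x\<bar> \<partial>P"

lemma weighted_measurable: "weighted p \<Longrightarrow> p \<in> borel_measurable P"
  by (simp add: weighted_def)

lemma weighted_abs:
  assumes "weighted p" shows "integrable P (\<lambda>x. V x * \<bar>p x\<bar>)"
proof -
  note [measurable] = weighted_measurable[OF assms]
  show "integrable P (\<lambda>x. V x * \<bar>p x\<bar>)"
    by (rule Bochner_Integration.integrable_bound[of P "\<lambda>x. V x * p x"])
      (use assms in \<open>auto simp: weighted_def abs_mult\<close>)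
qed

lemma weighted_diff: "weighted p \<Longrightarrow> weighted q \<Longrightarrow> weighted (\<lambda>x. p x - q x)"
  by (auto simp: weighted_def right_diff_distrib)

lemma weighted_zero [simp]: "weighted (\<lambda>_. 0)"
  by (simp add: weighted_def)

lemma weighted_imp_integrable:
  assumes "weighted p" shows "integrable P p"
proof (rule Bochner_Integration.integrable_bound[OF weighted_abs[OF assms]])
  show "AE x in P. norm (p x) \<le> norm (V x * \<bar>p x\<bar>)"
  proof (rule AE_I2)
    fix x assume "x \<in> space P"
    then have "1 * \<bar>p x\<bar> \<le> V x * \<bar>p x\<bar>" by (intro mult_right_mono V_ge1) auto
    then show "norm (p x) \<le> norm (V x * \<bar>p x\<bar>)" by simp
  qed
qed (rule weighted_measurable[OF assms])

lemma wnorm_nonneg: "0 \<le> wnorm p"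
  by (rule Bochner_Integration.integral_nonneg_AE) (auto intro!: AE_I2 mult_nonneg_nonneg dest: V_ge1)

lemma square_exp_moment: "integrable P (\<lambda>x. (V x)\<^sup>2 * exp (\<theta> * V x))"
proof (rule Bochner_Integration.integrable_bound)
  show "integrable P (\<lambda>x. 2 / \<theta>\<^sup>2 * exp (2 * \<theta> * V x))" using exp_moment by simp
  show "AE x in P. norm ((V x)\<^sup>2 * exp (\<theta> * V x)) \<le> norm (2 / \<theta>\<^sup>2 * exp (2 * \<theta> * V x))"
  proof (rule AE_I2)
    fix x assume x: "x \<in> space P"
    have V0: "0 \<le> \<theta> * V x" using \<theta>_pos V_ge1[OF x] by simp
    have "(\<theta> * V x)\<^sup>2 / 2 \<le> exp (\<theta> * V x)" using exp_lower_Taylor_quadratic[OF V0] V0 by linarith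
    then have "(V x)\<^sup>2 \<le> 2 / \<theta>\<^sup>2 * exp (\<theta> * V x)" using \<theta>_pos by (simp add: field_simps power_mult_distrib)
    then have "(V x)\<^sup>2 * exp (\<theta> * V x) \<le> 2 / \<theta>\<^sup>2 * exp (\<theta> * V x) * exp (\<theta> * V x)"
      by (rule mult_right_mono) simp
    also have "\<dots> = 2 / \<theta>\<^sup>2 * exp (2 * \<theta> * V x)" by (simp flip: exp_add)
    finally show "norm ((V x)\<^sup>2 * exp (\<theta> * V x)) \<le> norm (2 / \<theta>\<^sup>2 * exp (2 * \<theta> * V x))"
      by simp
  qed
qed measurable

lemma integrable_V: "integrable P V" and weighted_one: "weighted (\<lambda>_. 1)"
proof -
  show "integrable P V"
  proof (rule Bochner_Integration.integrable_bound[OF square_exp_moment])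
    show "AE x in P. norm (V x) \<le> norm ((V x)\<^sup>2 * exp (\<theta> * V x))"
    proof (rule AE_I2)
      fix x assume "x \<in> space P"
      then have V: "1 \<le> V x" by (rule V_ge1)
      then have "V x * 1 \<le> V x * (V x * exp (\<theta> * V x))"
        using \<theta>_pos mult_mono[of 1 "V x" 1 "exp (\<theta> * V x)"] by (intro mult_left_mono) auto
      then show "norm (V x) \<le> norm ((V x)\<^sup>2 * exp (\<theta> * V x))" using V by (simp add: power2_eq_square mult_ac)
    qed
  qed simp
  then show "weighted (\<lambda>_. 1)" by (simp add: weighted_def)
qed

lemma integrable_h_prod:
  assumes "\<And>t. t \<in> {1..T} \<Longrightarrow> weighted (p t)"
  shows "integrable (iid_space P T) (\<lambda>x. h x * (\<Prod>t=1..T. p t (x t)))"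
proof (rule Bochner_Integration.integrable_bound)
  show "integrable (iid_space P T) (\<lambda>x. \<Prod>t=1..T. V (x t) * \<bar>p t (x t)\<bar>)"
    using assms by (intro coords.product_integrable_prod weighted_abs) auto
  show "(\<lambda>x. h x * (\<Prod>t=1..T. p t (x t))) \<in> borel_measurable (iid_space P T)"
    using assms[THEN weighted_measurable] by measurable
  show "AE x in iid_space P T. norm (h x * (\<Prod>t=1..T. p t (x t))) \<le> norm (\<Prod>t=1..T. V (x t) * \<bar>p t (x t)\<bar>)"
  proof (rule AE_I2)
    fix x assume x: "x \<in> space (iid_space P T)"
    have "norm (h x * (\<Prod>t=1..T. p t (x t))) \<le> (\<Prod>t=1..T. V (x t)) * \<bar>\<Prod>t=1..T. p t (x t)\<bar>"
      using h_le_prod[OF x] by (simp add: abs_mult mult_right_mono)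
    also have "\<dots> = (\<Prod>t=1..T. V (x t) * \<bar>p t (x t)\<bar>)" by (simp add: prod.distrib abs_prod)
    finally show "norm (h x * (\<Prod>t=1..T. p t (x t))) \<le> norm (\<Prod>t=1..T. V (x t) * \<bar>p t (x t)\<bar>)" by simp
  qed
qed

text \<open>The function \<open>E[h(X) \<Prod>\<^bsub>r \<noteq> t\<^esub> p(X r) | X t = x]\<close> as an honest integral over the other coordinates; it is
  the partial derivative at \<open>p\<close>, in the \<open>t\<close>-th factor, of the multilinear form \<open>E[h \<Prod>p]\<close>.\<close>

definition partial_derivative :: "nat \<Rightarrow> ('a \<Rightarrow> real) \<Rightarrow> 'a \<Rightarrow> real" where
  "partial_derivative t p x =
     (\<integral>y. h (y(t := x)) * (\<Prod>r\<in>{1..T} - {t}. p (y r)) \<partial>(\<Pi>\<^sub>M r\<in>{1..T} - {t}. P))"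

definition gradient :: "('a \<Rightarrow> real) \<Rightarrow> 'a \<Rightarrow> real" where
  "gradient p x = (\<Sum>t=1..T. partial_derivative t p x)"

lemma insert_coordinate: "t \<in> {1..T} \<Longrightarrow> insert t ({1..T} - {t}) = {1..T}"
  by auto

lemma prod_distinguished_coordinate:
  fixes k l :: "'b \<Rightarrow> real"
  assumes "t \<in> {1..T}"
  shows "(\<Prod>r=1..T. (if r = t then k else l) (x r)) = k (x t) * (\<Prod>r\<in>{1..T} - {t}. l (x r))"
proof -
  have "(\<Prod>r\<in>insert t ({1..T} - {t}). (if r = t then k else l) (x r))
      = k (x t) * (\<Prod>r\<in>{1..T} - {t}. (if r = t then k else l) (x r))"
    by (subst prod.insert) auto
  also have "(\<Prod>r\<in>{1..T} - {t}. (if r = t then k else l) (x r)) = (\<Prod>r\<in>{1..T} - {t}. l (x r))"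
    by (intro prod.cong) auto
  finally show ?thesis unfolding insert_coordinate[OF assms] .
qed

lemma section_measurable:
  assumes t: "t \<in> {1..T}"
  shows "(\<lambda>(x, y). h (y(t := x))) \<in> borel_measurable (P \<Otimes>\<^sub>M (\<Pi>\<^sub>M r\<in>{1..T} - {t}. P))"
proof -
  have "(\<lambda>(x, y). y(t := x)) \<in> P \<Otimes>\<^sub>M (\<Pi>\<^sub>M r\<in>{1..T} - {t}. P) \<rightarrow>\<^sub>M (\<Pi>\<^sub>M r\<in>insert t ({1..T} - {t}). P)"
    using measurable_compose[OF measurable_pair_swap' measurable_add_dim[where M="\<lambda>_. P" and i=t and I="{1..T} - {t}"]]
    by (simp add: case_prod_beta')
  then have "(\<lambda>(x, y). y(t := x)) \<in> P \<Otimes>\<^sub>M (\<Pi>\<^sub>M r\<in>{1..T} - {t}. P) \<rightarrow>\<^sub>M iid_space P T"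
    unfolding insert_coordinate[OF t] .
  from measurable_compose[OF this h_measurable] show ?thesis by (simp add: case_prod_beta')
qed

lemma partial_derivative_measurable:
  assumes t: "t \<in> {1..T}" and p: "p \<in> borel_measurable P"
  shows "partial_derivative t p \<in> borel_measurable P"
proof -
  interpret J: finite_product_sigma_finite "\<lambda>_::nat. P" "{1..T} - {t}" by standard simp
  note [measurable] = section_measurable[OF t] p
  have "(\<lambda>(x, y). (case (x, y) of (x, y) \<Rightarrow> h (y(t := x))) * (\<Prod>r\<in>{1..T} - {t}. p (y r)))
     \<in> borel_measurable (P \<Otimes>\<^sub>M (\<Pi>\<^sub>M r\<in>{1..T} - {t}. P))"
    by measurable
  then have "(\<lambda>(x, y). h (y(t := x)) * (\<Prod>r\<in>{1..T} - {t}. p (y r)))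
     \<in> borel_measurable (P \<Otimes>\<^sub>M (\<Pi>\<^sub>M r\<in>{1..T} - {t}. P))" by simp
  then show ?thesis unfolding partial_derivative_def
    by (rule J.borel_measurable_lebesgue_integral)
qed

lemma section_bound:
  assumes t: "t \<in> {1..T}" and x: "x \<in> space P" and y: "y \<in> space (\<Pi>\<^sub>M r\<in>{1..T} - {t}. P)"
  shows "\<bar>h (y(t := x))\<bar> \<le> V x * (\<Prod>r\<in>{1..T} - {t}. V (y r))"
proof -
  have "y(t := x) \<in> space (iid_space P T)"
    using x y t by (auto simp: space_PiM PiE_iff extensional_def split: if_splits)
  then have "\<bar>h (y(t := x))\<bar> \<le> (\<Prod>r=1..T. V ((y(t := x)) r))" by (rule h_le_prod)
  also have "\<dots> = (\<Prod>r\<in>insert t ({1..T} - {t}). V ((y(t := x)) r))"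
    unfolding insert_coordinate[OF t] ..
  also have "\<dots> = V x * (\<Prod>r\<in>{1..T} - {t}. V (y r))" by (subst prod.insert) auto
  finally show ?thesis .
qed

lemma integrable_section:
  assumes t: "t \<in> {1..T}" and x: "x \<in> space P" and p: "weighted p"
  shows "integrable (\<Pi>\<^sub>M r\<in>{1..T} - {t}. P) (\<lambda>y. h (y(t := x)) * (\<Prod>r\<in>{1..T} - {t}. p (y r)))"
proof (rule Bochner_Integration.integrable_bound)
  let ?J = "{1..T} - {t}"
  note [measurable] = section_measurable[OF t] weighted_measurable[OF p]
  show "integrable (\<Pi>\<^sub>M r\<in>?J. P) (\<lambda>y. V x * (\<Prod>r\<in>?J. V (y r) * \<bar>p (y r)\<bar>))"
    using p by (intro integrable_mult_right coords.product_integrable_prod weighted_abs) auto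
  have "(\<lambda>y. case (x, y) of (x, y) \<Rightarrow> h (y(t := x))) \<in> borel_measurable (\<Pi>\<^sub>M r\<in>?J. P)"
    using x by measurable
  then have [measurable]: "(\<lambda>y. h (y(t := x))) \<in> borel_measurable (\<Pi>\<^sub>M r\<in>?J. P)" by simp
  show "(\<lambda>y. h (y(t := x)) * (\<Prod>r\<in>?J. p (y r))) \<in> borel_measurable (\<Pi>\<^sub>M r\<in>?J. P)" by measurable
  show "AE y in \<Pi>\<^sub>M r\<in>?J. P. norm (h (y(t := x)) * (\<Prod>r\<in>?J. p (y r)))
      \<le> norm (V x * (\<Prod>r\<in>?J. V (y r) * \<bar>p (y r)\<bar>))"
  proof (rule AE_I2)
    fix y assume y: "y \<in> space (\<Pi>\<^sub>M r\<in>?J. P)"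
    have "norm (h (y(t := x)) * (\<Prod>r\<in>?J. p (y r)))
        \<le> (V x * (\<Prod>r\<in>?J. V (y r))) * \<bar>\<Prod>r\<in>?J. p (y r)\<bar>"
      using section_bound[OF t x y] by (simp add: abs_mult mult_right_mono)
    also have "\<dots> = V x * (\<Prod>r\<in>?J. V (y r) * \<bar>p (y r)\<bar>)"
      by (simp add: prod.distrib abs_prod mult_ac)
    finally show "norm (h (y(t := x)) * (\<Prod>r\<in>?J. p (y r)))
      \<le> norm (V x * (\<Prod>r\<in>?J. V (y r) * \<bar>p (y r)\<bar>))" by simp
  qed
qed

text \<open>Integrating \<open>prod_diff_le\<close> against the weights factorises over the coordinates and leaves only the two
  norms of \<open>q\<close> and \<open>p - q\<close>. The factor \<open>V x\<close> is the one weight that is not integrated out.\<close>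

lemma partial_derivative_diff_bound:
  assumes t: "t \<in> {1..T}" and x: "x \<in> space P" and p: "weighted p" and q: "weighted q"
    and q_nonneg: "\<And>y. y \<in> space P \<Longrightarrow> 0 \<le> q y"
  shows "\<bar>partial_derivative t p x - partial_derivative t q x\<bar>
    \<le> V x * ((wnorm q + wnorm (\<lambda>y. p y - q y)) ^ (T - 1) - wnorm q ^ (T - 1))"
proof -
  let ?J = "{1..T} - {t}" and ?d = "\<lambda>y. p y - q y"
  let ?M = "\<Pi>\<^sub>M r\<in>?J. P"
  have cardJ: "card ?J = T - 1" using t by simp
  note d = weighted_diff[OF p q]
  have wq: "integrable P (\<lambda>y. V y * q y)" using q by (simp add: weighted_def)
  have wq_eq: "(\<integral>y. V y * q y \<partial>P) = wnorm q"
    using q_nonneg by (intro Bochner_Integration.integral_cong) auto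
  have int_sum: "integrable P (\<lambda>y. V y * q y + V y * \<bar>?d y\<bar>)"
    using wq weighted_abs[OF d] by simp
  have bound_int: "integrable ?M (\<lambda>y. \<Prod>r\<in>?J. V (y r) * q (y r) + V (y r) * \<bar>?d (y r)\<bar>)"
      "integrable ?M (\<lambda>y. \<Prod>r\<in>?J. V (y r) * q (y r))"
    using coords.product_integrable_prod[of ?J "\<lambda>_ y. V y * q y + V y * \<bar>?d y\<bar>"]
      coords.product_integrable_prod[of ?J "\<lambda>_ y. V y * q y"] int_sum wq by auto
  have "partial_derivative t p x - partial_derivative t q x
      = (\<integral>y. h (y(t := x)) * (\<Prod>r\<in>?J. p (y r)) - h (y(t := x)) * (\<Prod>r\<in>?J. q (y r)) \<partial>?M)"
    unfolding partial_derivative_def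
    using integrable_section[OF t x p] integrable_section[OF t x q] by simp
  also have "\<bar>\<dots>\<bar> \<le> (\<integral>y. V x * ((\<Prod>r\<in>?J. V (y r) * q (y r) + V (y r) * \<bar>?d (y r)\<bar>) - (\<Prod>r\<in>?J. V (y r) * q (y r))) \<partial>?M)"
  proof (rule integral_abs_bound[THEN order_trans], rule integral_mono)
    fix y assume y: "y \<in> space ?M"
    then have Vy: "1 \<le> V (y r)" "0 \<le> q (y r)" if "r \<in> ?J" for r
      using that V_ge1 q_nonneg by (auto simp: space_PiM PiE_iff)
    have "\<bar>h (y(t := x)) * (\<Prod>r\<in>?J. p (y r)) - h (y(t := x)) * (\<Prod>r\<in>?J. q (y r))\<bar>
        = \<bar>h (y(t := x))\<bar> * \<bar>(\<Prod>r\<in>?J. p (y r)) - (\<Prod>r\<in>?J. q (y r))\<bar>"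
      by (simp add: abs_mult flip: right_diff_distrib)
    also have "\<dots> \<le> (V x * (\<Prod>r\<in>?J. V (y r))) * ((\<Prod>r\<in>?J. q (y r) + \<bar>p (y r) - q (y r)\<bar>) - (\<Prod>r\<in>?J. q (y r)))"
    proof (rule mult_mono)
      show "\<bar>h (y(t := x))\<bar> \<le> V x * (\<Prod>r\<in>?J. V (y r))" by (rule section_bound[OF t x y])
      then show "0 \<le> V x * (\<Prod>r\<in>?J. V (y r))" by (rule order_trans[OF abs_ge_zero])
      show "\<bar>(\<Prod>r\<in>?J. p (y r)) - (\<Prod>r\<in>?J. q (y r))\<bar>
          \<le> (\<Prod>r\<in>?J. q (y r) + \<bar>p (y r) - q (y r)\<bar>) - (\<Prod>r\<in>?J. q (y r))"
        using Vy by (intro prod_diff_le) auto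
    qed simp
    also have "\<dots> = V x * ((\<Prod>r\<in>?J. V (y r) * q (y r) + V (y r) * \<bar>?d (y r)\<bar>) - (\<Prod>r\<in>?J. V (y r) * q (y r)))"
      by (simp add: prod.distrib right_diff_distrib mult_ac flip: distrib_left)
    finally show "\<bar>h (y(t := x)) * (\<Prod>r\<in>?J. p (y r)) - h (y(t := x)) * (\<Prod>r\<in>?J. q (y r))\<bar> \<le> \<dots>" .
  qed (use integrable_section[OF t x p] integrable_section[OF t x q] bound_int in auto)
  also have "\<dots> = V x * ((\<Prod>r\<in>?J. \<integral>y. V y * q y + V y * \<bar>?d y\<bar> \<partial>P) - (\<Prod>r\<in>?J. \<integral>y. V y * q y \<partial>P))"
    using bound_int coords.product_integral_prod[of ?J "\<lambda>_ y. V y * q y + V y * \<bar>?d y\<bar>"]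
      coords.product_integral_prod[of ?J "\<lambda>_ y. V y * q y"] int_sum wq by simp
  also have "(\<integral>y. V y * q y + V y * \<bar>?d y\<bar> \<partial>P) = wnorm q + wnorm ?d"
    using wq weighted_abs[OF d] wq_eq by simp
  finally show ?thesis unfolding wq_eq prod_constant cardJ .
qed

text \<open>The previous bound with \<open>q = 0\<close>; it needs at least one other coordinate, so that the product vanishes at \<open>0\<close>.\<close>

lemma partial_derivative_bound:
  assumes t: "t \<in> {1..T}" and x: "x \<in> space P" and p: "weighted p"
  shows "\<bar>partial_derivative t p x\<bar> \<le> V x * wnorm p ^ (T - 1)"
proof -
  have "(\<Prod>r\<in>{1..T} - {t}. (0::real)) = 0" using t T_ge2 by (subst prod_constant) simp
  then have "partial_derivative t (\<lambda>_. 0) x = 0" by (simp add: partial_derivative_def)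
  then show ?thesis
    using partial_derivative_diff_bound[OF t x p weighted_zero] T_ge2 by (simp add: zero_power)
qed

text \<open>Fubini. It is used twice: with a difference of densities as \<open>k\<close> to express the linear term of the functional, and with
  indicators to identify conditional expectations.\<close>

lemma integral_against_partial_derivative:
  assumes t: "t \<in> {1..T}" and p: "weighted p" and k: "weighted k"
  shows "integrable P (\<lambda>x. k x * partial_derivative t p x)"
    and "(\<integral>x. k x * partial_derivative t p x \<partial>P)
      = (\<integral>x. h x * (k (x t) * (\<Prod>r\<in>{1..T} - {t}. p (x r))) \<partial>iid_space P T)"
proof -
  let ?J = "{1..T} - {t}"
  let ?M = "\<Pi>\<^sub>M r\<in>?J. P"
  note [measurable] = weighted_measurable[OF p] weighted_measurable[OF k]
    partial_derivative_measurable[OF t weighted_measurable[OF p]] section_measurable[OF t]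
  interpret J: finite_product_sigma_finite "\<lambda>_::nat. P" ?J by standard simp
  interpret PJ: pair_sigma_finite P ?M ..
  show "integrable P (\<lambda>x. k x * partial_derivative t p x)"
  proof (rule Bochner_Integration.integrable_bound)
    show "integrable P (\<lambda>x. wnorm p ^ (T - 1) * (V x * \<bar>k x\<bar>))"
      using weighted_abs[OF k] by simp
    show "AE x in P. norm (k x * partial_derivative t p x) \<le> norm (wnorm p ^ (T - 1) * (V x * \<bar>k x\<bar>))"
    proof (rule AE_I2)
      fix x assume x: "x \<in> space P"
      have "norm (k x * partial_derivative t p x) \<le> \<bar>k x\<bar> * (V x * wnorm p ^ (T - 1))"
        using partial_derivative_bound[OF t x p] by (simp add: abs_mult mult_left_mono)
      also have "\<dots> \<le> norm (wnorm p ^ (T - 1) * (V x * \<bar>k x\<bar>))" by (simp add: mult_ac)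
      finally show "norm (k x * partial_derivative t p x) \<le> norm (wnorm p ^ (T - 1) * (V x * \<bar>k x\<bar>))" .
    qed
  qed measurable
  let ?f = "\<lambda>x. h x * (k (x t) * (\<Prod>r\<in>?J. p (x r)))"
  have f_int: "integrable (iid_space P T) ?f"
    using integrable_h_prod[of "\<lambda>r. if r = t then k else p"] p k unfolding prod_distinguished_coordinate[OF t] by simp
  have upd: "(\<Prod>r\<in>?J. p ((y(t := x)) r)) = (\<Prod>r\<in>?J. p (y r))" for x y
    by (intro prod.cong) auto
  have "(\<integral>x. ?f x \<partial>iid_space P T) = (\<integral>x. ?f x \<partial>(\<Pi>\<^sub>M r\<in>insert t ?J. P))"
    unfolding insert_coordinate[OF t] ..
  also have "\<dots> = (\<integral>y. \<integral>x. ?f (y(t := x)) \<partial>P \<partial>?M)"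
    using f_int by (intro coords.product_integral_insert) (auto simp: insert_coordinate[OF t, simplified] insert_coordinate[OF t])
  also have "\<dots> = (\<integral>y. \<integral>x. h (y(t := x)) * (k x * (\<Prod>r\<in>?J. p (y r))) \<partial>P \<partial>?M)"
    by (simp only: upd fun_upd_same)
  also have "\<dots> = (\<integral>x. \<integral>y. h (y(t := x)) * (k x * (\<Prod>r\<in>?J. p (y r))) \<partial>?M \<partial>P)"
  proof (rule PJ.Fubini_integral)
    have [measurable]: "(\<lambda>(x, y). h (y(t := x)) * (k x * (\<Prod>r\<in>?J. p (y r)))) \<in> borel_measurable (P \<Otimes>\<^sub>M ?M)"
    proof -
      have "(\<lambda>(x, y). (case (x, y) of (x, y) \<Rightarrow> h (y(t := x))) * (k x * (\<Prod>r\<in>?J. p (y r)))) \<in> borel_measurable (P \<Otimes>\<^sub>M ?M)"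
        by measurable
      then show ?thesis by simp
    qed
    have a_int: "integrable P (\<lambda>x. V x * \<bar>k x\<bar>)" using weighted_abs[OF k] .
    have b_int: "integrable ?M (\<lambda>y. \<Prod>r\<in>?J. V (y r) * \<bar>p (y r)\<bar>)"
      using p by (intro coords.product_integrable_prod weighted_abs) auto
    have dom: "integrable (P \<Otimes>\<^sub>M ?M) (\<lambda>z. (V (fst z) * \<bar>k (fst z)\<bar>) * (\<Prod>r\<in>?J. V (snd z r) * \<bar>p (snd z r)\<bar>))"
    proof (rule PJ.Fubini_integrable)
      show "integrable P (\<lambda>x. \<integral>y. norm ((V (fst (x, y)) * \<bar>k (fst (x, y))\<bar>) * (\<Prod>r\<in>?J. V (snd (x, y) r) * \<bar>p (snd (x, y) r)\<bar>)) \<partial>?M)"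
        using integrable_norm[OF a_int] by (simp add: norm_mult abs_mult)
    qed (use b_int in \<open>auto intro!: AE_I2 integrable_mult_right\<close>)
    show "integrable (P \<Otimes>\<^sub>M ?M) (\<lambda>(x, y). h (y(t := x)) * (k x * (\<Prod>r\<in>?J. p (y r))))"
    proof (rule Bochner_Integration.integrable_bound[OF dom], measurable, rule AE_I2)
      fix z assume "z \<in> space (P \<Otimes>\<^sub>M ?M)"
      then obtain x y where z: "z = (x, y)" and x: "x \<in> space P" and y: "y \<in> space ?M"
        by (auto simp: space_pair_measure)
      have "\<bar>h (y(t := x))\<bar> * \<bar>k x * (\<Prod>r\<in>?J. p (y r))\<bar> \<le> V x * (\<Prod>r\<in>?J. V (y r)) * \<bar>k x * (\<Prod>r\<in>?J. p (y r))\<bar>"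
        using section_bound[OF t x y] by (intro mult_right_mono) auto
      also have "\<dots> = V x * \<bar>k x\<bar> * (\<Prod>r\<in>?J. V (y r) * \<bar>p (y r)\<bar>)"
        by (simp add: prod.distrib abs_mult abs_prod mult_ac)
      also have "\<dots> \<le> norm \<dots>" by simp
      finally show "norm (case z of (x, y) \<Rightarrow> h (y(t := x)) * (k x * (\<Prod>r\<in>?J. p (y r))))
         \<le> norm ((V (fst z) * \<bar>k (fst z)\<bar>) * (\<Prod>r\<in>?J. V (snd z r) * \<bar>p (snd z r)\<bar>))"
        unfolding z by (simp add: abs_mult)
    qed
  qed
  also have "\<dots> = (\<integral>x. k x * partial_derivative t p x \<partial>P)"
    unfolding partial_derivative_def
    by (intro Bochner_Integration.integral_cong) (auto simp: mult_ac simp flip: integral_mult_right_zero)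
  finally show "(\<integral>x. k x * partial_derivative t p x \<partial>P) = (\<integral>x. ?f x \<partial>iid_space P T)" ..
qed

section \<open>Second-order expansion of the multilinear form\<close>

text \<open>The integrand is \<open>h\<close> times the left-hand side of \<open>prod_diff_linear_le\<close>. Absorbing the weights into the
  factors and integrating turns the bound there into \<open>(b + d) ^ T - b ^ T - T d b ^ (T - 1)\<close> with \<open>b\<close> and \<open>d\<close>
  the norms of \<open>q\<close> and \<open>p - q\<close>.\<close>

lemma linear_remainder_bound:
  assumes p: "weighted p" and q: "weighted q" and q_nonneg: "\<And>x. x \<in> space P \<Longrightarrow> 0 \<le> q x"
    and B: "1 \<le> B" "wnorm q \<le> B" "wnorm (\<lambda>x. p x - q x) \<le> 2 * B"
  shows "(\<integral>x. h x * (\<Prod>t=1..T. p (x t)) \<partial>iid_space P T) - (\<integral>x. h x * (\<Prod>t=1..T. q (x t)) \<partial>iid_space P T)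
      - (\<integral>x. (p x - q x) * gradient q x \<partial>P)
    \<le> (real T)\<^sup>2 * (3 * B) ^ T * (wnorm (\<lambda>x. p x - q x))\<^sup>2"
proof -
  let ?d = "\<lambda>x. p x - q x"
  let ?D = "\<lambda>x. V x * \<bar>?d x\<bar>" and ?b = "\<lambda>x. V x * q x"
  let ?J = "\<lambda>t. {1..T} - {t}"
  have d: "weighted ?d" using p q by (rule weighted_diff)
  have b_int: "integrable P ?b" using q by (simp add: weighted_def)
  have D_int: "integrable P ?D" by (rule weighted_abs[OF d])
  have b_eq: "(\<integral>x. ?b x \<partial>P) = wnorm q"
    using q_nonneg by (intro Bochner_Integration.integral_cong) auto
  note single = prod_distinguished_coordinate
  have h_lin: "integrable (iid_space P T) (\<lambda>x. h x * (?d (x t) * (\<Prod>r\<in>?J t. q (x r))))" if "t \<in> {1..T}" for t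
    using integrable_h_prod[of "\<lambda>r. if r = t then ?d else q"] d q unfolding single[OF that] by simp
  have D_lin: "integrable (iid_space P T) (\<lambda>x. ?D (x t) * (\<Prod>r\<in>?J t. ?b (x r)))"
    "(\<integral>x. ?D (x t) * (\<Prod>r\<in>?J t. ?b (x r)) \<partial>iid_space P T) = wnorm ?d * wnorm q ^ (T - 1)"
    if "t \<in> {1..T}" for t
  proof -
    have I: "integrable P ((if r = t then ?D else ?b))" for r using b_int D_int by simp
    show "integrable (iid_space P T) (\<lambda>x. ?D (x t) * (\<Prod>r\<in>?J t. ?b (x r)))"
      using coords.product_integrable_prod[of "{1..T}" "\<lambda>r. if r = t then ?D else ?b"] I
      unfolding single[OF that] by simp
    have "(\<integral>x. ?D (x t) * (\<Prod>r\<in>?J t. ?b (x r)) \<partial>iid_space P T) = (\<Prod>r=1..T. \<integral>x. (if r = t then ?D else ?b) x \<partial>P)"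
      using coords.product_integral_prod[of "{1..T}" "\<lambda>r. if r = t then ?D else ?b"] I
      unfolding single[OF that] by simp
    also have "\<dots> = (\<Prod>r\<in>insert t (?J t). \<integral>x. (if r = t then ?D else ?b) x \<partial>P)"
      unfolding insert_coordinate[OF that] ..
    also have "\<dots> = wnorm ?d * (\<Prod>r\<in>?J t. \<integral>x. (if r = t then ?D else ?b) x \<partial>P)"
      by (subst prod.insert) auto
    also have "(\<Prod>r\<in>?J t. \<integral>x. (if r = t then ?D else ?b) x \<partial>P) = (\<Prod>r\<in>?J t. wnorm q)"
      using b_eq by (intro prod.cong) auto
    also have "\<dots> = wnorm q ^ (T - 1)" using that by simp
    finally show "(\<integral>x. ?D (x t) * (\<Prod>r\<in>?J t. ?b (x r)) \<partial>iid_space P T) = wnorm ?d * wnorm q ^ (T - 1)" .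
  qed
  have grad: "(\<integral>x. ?d x * gradient q x \<partial>P) = (\<Sum>t=1..T. \<integral>x. h x * (?d (x t) * (\<Prod>r\<in>?J t. q (x r))) \<partial>iid_space P T)"
    unfolding gradient_def sum_distrib_left
    using integral_against_partial_derivative[OF _ q d] by (subst Bochner_Integration.integral_sum) auto
  have int_prod: "integrable (iid_space P T) (\<lambda>x. \<Prod>t=1..T. ?b (x t) + ?D (x t))"
    "integrable (iid_space P T) (\<lambda>x. \<Prod>t=1..T. ?b (x t))"
    using coords.product_integrable_prod[of "{1..T}" "\<lambda>_ x. ?b x + ?D x"]
      coords.product_integrable_prod[of "{1..T}" "\<lambda>_. ?b"] b_int D_int by auto
  note ints = integrable_h_prod[of "\<lambda>_. p", OF p] integrable_h_prod[of "\<lambda>_. q", OF q]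
  have lin_int: "integrable (iid_space P T) (\<lambda>x. \<Sum>t=1..T. h x * (?d (x t) * (\<Prod>r\<in>?J t. q (x r))))"
    by (intro Bochner_Integration.integrable_sum h_lin)
  have lin_eq: "(\<integral>x. (\<Sum>t=1..T. h x * (?d (x t) * (\<Prod>r\<in>?J t. q (x r)))) \<partial>iid_space P T)
      = (\<Sum>t=1..T. \<integral>x. h x * (?d (x t) * (\<Prod>r\<in>?J t. q (x r))) \<partial>iid_space P T)"
    by (intro Bochner_Integration.integral_sum h_lin)
  have "(\<integral>x. h x * (\<Prod>t=1..T. p (x t)) \<partial>iid_space P T) - (\<integral>x. h x * (\<Prod>t=1..T. q (x t)) \<partial>iid_space P T)
      - (\<integral>x. ?d x * gradient q x \<partial>P)
    = (\<integral>x. h x * (\<Prod>t=1..T. p (x t)) - h x * (\<Prod>t=1..T. q (x t))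
        - (\<Sum>t=1..T. h x * (?d (x t) * (\<Prod>r\<in>?J t. q (x r)))) \<partial>iid_space P T)"
    unfolding grad lin_eq[symmetric] using ints lin_int by simp
  also have "\<dots> \<le> (\<integral>x. (\<Prod>t=1..T. ?b (x t) + ?D (x t)) - (\<Prod>t=1..T. ?b (x t))
        - (\<Sum>t=1..T. ?D (x t) * (\<Prod>r\<in>?J t. ?b (x r))) \<partial>iid_space P T)"
  proof (rule integral_mono)
    fix x assume x: "x \<in> space (iid_space P T)"
    then have xr: "x r \<in> space P" if "r \<in> {1..T}" for r using that by (auto simp: space_PiM PiE_iff)
    let ?X = "\<Prod>t=1..T. V (x t)"
    let ?rem = "(\<Prod>t=1..T. p (x t)) - (\<Prod>t=1..T. q (x t)) - (\<Sum>t=1..T. ?d (x t) * (\<Prod>r\<in>?J t. q (x r)))"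
    have X: "\<bar>h x\<bar> \<le> ?X" by (rule h_le_prod[OF x])
    have absorb: "?X * (k * (\<Prod>r\<in>?J t. q (x r))) = V (x t) * k * (\<Prod>r\<in>?J t. ?b (x r))"
      if "t \<in> {1..T}" for t and k :: real
      using single[OF that, of V V x] by (simp add: prod.distrib mult_ac)
    have "h x * (\<Prod>t=1..T. p (x t)) - h x * (\<Prod>t=1..T. q (x t))
        - (\<Sum>t=1..T. h x * (?d (x t) * (\<Prod>r\<in>?J t. q (x r)))) = h x * ?rem"
      by (simp add: algebra_simps sum_distrib_left)
    also have "\<dots> \<le> \<bar>h x\<bar> * \<bar>?rem\<bar>" by (simp only: abs_mult[symmetric] abs_ge_self)
    also have "\<dots> \<le> ?X * ((\<Prod>t=1..T. q (x t) + \<bar>p (x t) - q (x t)\<bar>) - (\<Prod>t=1..T. q (x t))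
        - (\<Sum>t=1..T. \<bar>p (x t) - q (x t)\<bar> * (\<Prod>r\<in>?J t. q (x r))))"
    proof (rule mult_mono[OF X])
      show "0 \<le> ?X" using X by linarith
      show "\<bar>?rem\<bar> \<le> (\<Prod>t=1..T. q (x t) + \<bar>p (x t) - q (x t)\<bar>) - (\<Prod>t=1..T. q (x t))
        - (\<Sum>t=1..T. \<bar>p (x t) - q (x t)\<bar> * (\<Prod>r\<in>?J t. q (x r)))"
        using xr q_nonneg by (intro prod_diff_linear_le) auto
    qed simp
    also have "\<dots> = (\<Prod>t=1..T. ?b (x t) + ?D (x t)) - (\<Prod>t=1..T. ?b (x t))
        - (\<Sum>t=1..T. ?X * (\<bar>?d (x t)\<bar> * (\<Prod>r\<in>?J t. q (x r))))"
      by (simp add: right_diff_distrib sum_distrib_left flip: distrib_left) (simp add: prod.distrib)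
    also have "(\<Sum>t=1..T. ?X * (\<bar>?d (x t)\<bar> * (\<Prod>r\<in>?J t. q (x r)))) = (\<Sum>t=1..T. ?D (x t) * (\<Prod>r\<in>?J t. ?b (x r)))"
      by (intro sum.cong refl absorb)
    finally show "h x * (\<Prod>t=1..T. p (x t)) - h x * (\<Prod>t=1..T. q (x t))
        - (\<Sum>t=1..T. h x * (?d (x t) * (\<Prod>r\<in>?J t. q (x r))))
      \<le> (\<Prod>t=1..T. ?b (x t) + ?D (x t)) - (\<Prod>t=1..T. ?b (x t))
        - (\<Sum>t=1..T. ?D (x t) * (\<Prod>r\<in>?J t. ?b (x r)))" .
  qed (intro Bochner_Integration.integrable_diff Bochner_Integration.integrable_sum ints h_lin int_prod D_lin(1); assumption)+
  also have "\<dots> = (\<Prod>t=1..T. \<integral>x. ?b x + ?D x \<partial>P) - (\<Prod>t=1..T. \<integral>x. ?b x \<partial>P) - (\<Sum>t=1..T. wnorm ?d * wnorm q ^ (T - 1))"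
  proof -
    have "integrable (iid_space P T) (\<lambda>x. \<Sum>t=1..T. ?D (x t) * (\<Prod>r\<in>?J t. ?b (x r)))"
      by (intro Bochner_Integration.integrable_sum D_lin(1))
    moreover have "(\<integral>x. (\<Sum>t=1..T. ?D (x t) * (\<Prod>r\<in>?J t. ?b (x r))) \<partial>iid_space P T)
        = (\<Sum>t=1..T. wnorm ?d * wnorm q ^ (T - 1))"
      by (subst Bochner_Integration.integral_sum, rule D_lin(1), assumption, intro sum.cong refl D_lin(2))
    moreover have "(\<integral>x. (\<Prod>t=1..T. ?b (x t) + ?D (x t)) \<partial>iid_space P T) = (\<Prod>t=1..T. \<integral>x. ?b x + ?D x \<partial>P)"
      using b_int D_int by (intro coords.product_integral_prod) auto
    moreover have "(\<integral>x. (\<Prod>t=1..T. ?b (x t)) \<partial>iid_space P T) = (\<Prod>t=1..T. \<integral>x. ?b x \<partial>P)"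
      using b_int by (intro coords.product_integral_prod) auto
    ultimately show ?thesis
      using int_prod by (simp only: Bochner_Integration.integral_diff Bochner_Integration.integrable_diff)
  qed
  also have "\<dots> = (wnorm q + wnorm ?d) ^ T - wnorm q ^ T - real T * (wnorm ?d * wnorm q ^ (T - 1))"
    using b_int D_int b_eq by simp
  also have "\<dots> \<le> (real T)\<^sup>2 * (wnorm ?d)\<^sup>2 * (3 * B) ^ T"
    using B by (intro power_diff_linear_le wnorm_nonneg) auto
  finally show ?thesis by (simp add: mult_ac)
qed

section \<open>Gibbs densities with exponent proportional to the weight\<close>

definition gibbs :: "('a \<Rightarrow> real) \<Rightarrow> 'a \<Rightarrow> real" where
  "gibbs w x = exp (w x * V x) / (\<integral>y. exp (w y * V y) \<partial>P)"

text \<open>A lower bound for all normalising constants of \<open>gibbs w\<close> with \<open>\<bar>w\<bar> \<le> \<theta>\<close>.\<close>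

definition partition_min :: real where "partition_min = (\<integral>x. exp (- \<theta> * V x) \<partial>P)"
definition square_exp_mean :: real where "square_exp_mean = (\<integral>x. (V x)\<^sup>2 * exp (\<theta> * V x) \<partial>P)"

definition admissible :: "real \<Rightarrow> ('a \<Rightarrow> real) \<Rightarrow> bool" where
  "admissible \<epsilon> w \<longleftrightarrow> w \<in> borel_measurable P \<and> (\<forall>x\<in>space P. \<bar>w x\<bar> \<le> \<epsilon>)"

lemma admissible_measurable: "admissible \<epsilon> w \<Longrightarrow> w \<in> borel_measurable P"
  by (simp add: admissible_def)

lemma admissible_mono: "admissible \<epsilon> w \<Longrightarrow> \<epsilon> \<le> \<epsilon>' \<Longrightarrow> admissible \<epsilon>' w"
  by (force simp: admissible_def)

lemma admissible_exponent:
  assumes "admissible \<epsilon> w" "x \<in> space P" shows "\<bar>w x * V x\<bar> \<le> \<epsilon> * V x"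
  using assms V_ge1[OF assms(2)] by (auto simp: admissible_def abs_mult intro!: mult_right_mono)

lemma integrable_exp_V: "integrable P (\<lambda>x. exp (\<theta> * V x))"
  and integrable_V_exp_V: "integrable P (\<lambda>x. V x * exp (\<theta> * V x))"
proof -
  have le: "exp (\<theta> * V x) \<le> V x * exp (\<theta> * V x)" "V x * exp (\<theta> * V x) \<le> (V x)\<^sup>2 * exp (\<theta> * V x)"
    if "x \<in> space P" for x
    using V_ge1[OF that] mult_left_mono[of 1 "V x" "V x"] by (auto simp: power2_eq_square mult_right_mono)
  show *: "integrable P (\<lambda>x. V x * exp (\<theta> * V x))"
  proof (rule Bochner_Integration.integrable_bound[OF square_exp_moment])
    show "AE x in P. norm (V x * exp (\<theta> * V x)) \<le> norm ((V x)\<^sup>2 * exp (\<theta> * V x))"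
    proof (rule AE_I2)
      fix x assume x: "x \<in> space P"
      have "0 \<le> V x * exp (\<theta> * V x)" using V_ge1[OF x] by simp
      then show "norm (V x * exp (\<theta> * V x)) \<le> norm ((V x)\<^sup>2 * exp (\<theta> * V x))"
        using le(2)[OF x] unfolding real_norm_def by linarith
    qed
  qed measurable
  show "integrable P (\<lambda>x. exp (\<theta> * V x))"
  proof (rule Bochner_Integration.integrable_bound[OF *])
    show "AE x in P. norm (exp (\<theta> * V x)) \<le> norm (V x * exp (\<theta> * V x))"
    proof (rule AE_I2)
      fix x assume x: "x \<in> space P"
      show "norm (exp (\<theta> * V x)) \<le> norm (V x * exp (\<theta> * V x))"
        using le(1)[OF x] unfolding real_norm_def abs_exp_cancel by linarith
    qed
  qed measurable
qed

lemma integrable_tilt: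
  assumes w: "admissible \<theta> w"
  shows "integrable P (\<lambda>x. exp (w x * V x))" "integrable P (\<lambda>x. V x * exp (w x * V x))"
proof -
  note [measurable] = admissible_measurable[OF w]
  have le: "exp (w x * V x) \<le> exp (\<theta> * V x)" if "x \<in> space P" for x
    using abs_le_D1[OF admissible_exponent[OF w that]] by (simp only: exp_le_cancel_iff)
  show "integrable P (\<lambda>x. exp (w x * V x))"
    by (rule Bochner_Integration.integrable_bound[OF integrable_exp_V])
      (measurable, simp only: real_norm_def abs_exp_cancel, rule AE_I2, rule le)
  show "integrable P (\<lambda>x. V x * exp (w x * V x))"
  proof (rule Bochner_Integration.integrable_bound[OF integrable_V_exp_V])
    show "AE x in P. norm (V x * exp (w x * V x)) \<le> norm (V x * exp (\<theta> * V x))"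
      by (simp only: real_norm_def abs_mult abs_exp_cancel)
        (intro AE_I2 mult_left_mono le abs_ge_zero)
  qed measurable
qed

lemma partition_min_pos: "0 < partition_min" and partition_min_le: "admissible \<theta> w \<Longrightarrow> partition_min \<le> (\<integral>x. exp (w x * V x) \<partial>P)"
proof -
  have adm: "admissible \<theta> (\<lambda>_. - \<theta>)" using \<theta>_pos by (simp add: admissible_def)
  note int = integrable_tilt(1)[OF adm]
  have "partition_min \<noteq> 0"
  proof
    assume "partition_min = 0"
    then have "AE x in P. exp (- \<theta> * V x) = 0"
      using integral_nonneg_eq_0_iff_AE[OF int] by (simp add: partition_min_def)
    then show False by simp
  qed
  moreover have "0 \<le> partition_min" unfolding partition_min_def by simp
  ultimately show "0 < partition_min" by simp
  assume w: "admissible \<theta> w"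
  show "partition_min \<le> (\<integral>x. exp (w x * V x) \<partial>P)" unfolding partition_min_def
  proof (rule integral_mono[OF int integrable_tilt(1)[OF w]])
    fix x assume "x \<in> space P"
    from admissible_exponent[OF w this] show "exp (- \<theta> * V x) \<le> exp (w x * V x)" by simp
  qed
qed

lemma square_exp_mean_nonneg: "0 \<le> square_exp_mean" unfolding square_exp_mean_def by simp

lemma partition_pos: "admissible \<theta> w \<Longrightarrow> 0 < (\<integral>x. exp (w x * V x) \<partial>P)"
  using partition_min_pos partition_min_le by (rule less_le_trans)

lemma gibbs_pos: "admissible \<theta> w \<Longrightarrow> 0 < gibbs w x"
  by (simp add: gibbs_def partition_pos)

lemma gibbs_weighted: assumes w: "admissible \<theta> w" shows "weighted (gibbs w)"
  using integrable_tilt(2)[OF w] admissible_measurable[OF w]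
  by (auto simp: weighted_def gibbs_def[abs_def])

lemma integral_gibbs: assumes w: "admissible \<theta> w" shows "(\<integral>x. gibbs w x \<partial>P) = 1"
  using partition_pos[OF w] by (simp add: gibbs_def)

text \<open>The numerator is Lipschitz in \<open>w\<close> with constant \<open>V exp (\<theta> V)\<close>, and the normalising constant with its expectation.
  The norm contributes one more \<open>V\<close>; this is why \<open>E[V\<^sup>2 exp (\<theta> V)]\<close> enters.\<close>

lemma gibbs_lipschitz:
  assumes u: "admissible \<theta> u" and v: "admissible \<theta> v" and uv: "\<And>x. x \<in> space P \<Longrightarrow> \<bar>u x - v x\<bar> \<le> q"
  shows "wnorm (\<lambda>x. gibbs u x - gibbs v x) \<le> q * (square_exp_mean / partition_min + (square_exp_mean / partition_min)\<^sup>2)"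
proof -
  let ?e = "\<lambda>x. exp (\<theta> * V x)"
  let ?Z = "\<lambda>w. \<integral>x. exp (w x * V x) \<partial>P"
  note [measurable] = admissible_measurable[OF u] admissible_measurable[OF v]
  have q: "0 \<le> q" using uv not_empty by (meson abs_ge_zero all_not_in_conv order_trans)
  have diff: "\<bar>exp (u x * V x) - exp (v x * V x)\<bar> \<le> q * (V x * ?e x)" if x: "x \<in> space P" for x
  proof -
    have "\<bar>exp (u x * V x) - exp (v x * V x)\<bar> \<le> \<bar>u x * V x - v x * V x\<bar> * ?e x"
      using admissible_exponent[OF u x] admissible_exponent[OF v x] by (intro exp_diff_le) auto
    also have "\<bar>u x * V x - v x * V x\<bar> \<le> q * V x"
      using uv[OF x] V_ge1[OF x] by (simp add: abs_mult mult_right_mono flip: left_diff_distrib)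
    finally show ?thesis by (simp add: mult_ac)
  qed
  have V_le: "V x * ?e x \<le> (V x)\<^sup>2 * ?e x" if "x \<in> space P" for x
    using V_ge1[OF that] mult_left_mono[of 1 "V x" "V x"] by (auto simp: power2_eq_square mult_right_mono)
  have int_V: "(\<integral>x. V x * ?e x \<partial>P) \<le> square_exp_mean" unfolding square_exp_mean_def
    by (intro integral_mono integrable_V_exp_V square_exp_moment V_le)
  have "\<bar>?Z u - ?Z v\<bar> = \<bar>\<integral>x. exp (u x * V x) - exp (v x * V x) \<partial>P\<bar>"
    using integrable_tilt(1)[OF u] integrable_tilt(1)[OF v] by simp
  also have "\<dots> \<le> (\<integral>x. q * (V x * ?e x) \<partial>P)"
    using integrable_tilt(1)[OF u] integrable_tilt(1)[OF v] integrable_V_exp_V diff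
    by (intro integral_abs_bound[THEN order_trans] integral_mono) auto
  also have "\<dots> \<le> q * square_exp_mean" using int_V q by (simp add: mult_left_mono)
  finally have Z: "\<bar>?Z u - ?Z v\<bar> \<le> q * square_exp_mean" .
  have point: "V x * \<bar>gibbs u x - gibbs v x\<bar> \<le> q / partition_min * ((V x)\<^sup>2 * ?e x) + q * square_exp_mean / partition_min\<^sup>2 * (V x * ?e x)"
    if x: "x \<in> space P" for x
  proof -
    have V0: "0 \<le> V x" using V_ge1[OF x] by simp
    have "\<bar>gibbs u x - gibbs v x\<bar>
        \<le> \<bar>exp (u x * V x) - exp (v x * V x)\<bar> / ?Z u + exp (v x * V x) * (\<bar>?Z v - ?Z u\<bar> / (?Z u * ?Z v))"
      unfolding gibbs_def
      by (rule quotient_diff_le[OF partition_pos[OF u] partition_pos[OF v] exp_ge_zero])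
    also have "\<dots> \<le> q * (V x * ?e x) / partition_min + ?e x * (q * square_exp_mean / (partition_min * partition_min))"
    proof (rule add_mono)
      show "\<bar>exp (u x * V x) - exp (v x * V x)\<bar> / ?Z u \<le> q * (V x * ?e x) / partition_min"
        by (rule frac_le[OF _ diff[OF x] partition_min_pos partition_min_le[OF u]]) (use q V0 in simp)
      show "exp (v x * V x) * (\<bar>?Z v - ?Z u\<bar> / (?Z u * ?Z v)) \<le> ?e x * (q * square_exp_mean / (partition_min * partition_min))"
      proof (rule mult_mono)
        show "exp (v x * V x) \<le> ?e x" using abs_le_D1[OF admissible_exponent[OF v x]] by (simp only: exp_le_cancel_iff)
        show "\<bar>?Z v - ?Z u\<bar> / (?Z u * ?Z v) \<le> q * square_exp_mean / (partition_min * partition_min)"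
        proof (rule frac_le)
          show "\<bar>?Z v - ?Z u\<bar> \<le> q * square_exp_mean" using Z by (simp only: abs_minus_commute)
          show "partition_min * partition_min \<le> ?Z u * ?Z v"
            using partition_min_pos partition_min_le[OF u] partition_min_le[OF v] by (intro mult_mono) auto
        qed (use q square_exp_mean_nonneg partition_min_pos in auto)
        show "0 \<le> \<bar>?Z v - ?Z u\<bar> / (?Z u * ?Z v)"
          using partition_pos[OF u] partition_pos[OF v] by simp
      qed simp
    qed
    finally have "V x * \<bar>gibbs u x - gibbs v x\<bar> \<le> V x * (q * (V x * ?e x) / partition_min + ?e x * (q * square_exp_mean / (partition_min * partition_min)))"
      using V0 by (rule mult_left_mono)
    also have "\<dots> = q / partition_min * ((V x)\<^sup>2 * ?e x) + q * square_exp_mean / partition_min\<^sup>2 * (V x * ?e x)"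
      by (simp add: power2_eq_square algebra_simps)
    finally show ?thesis .
  qed
  have "wnorm (\<lambda>x. gibbs u x - gibbs v x) \<le> (\<integral>x. q / partition_min * ((V x)\<^sup>2 * ?e x) + q * square_exp_mean / partition_min\<^sup>2 * (V x * ?e x) \<partial>P)"
    by (intro integral_mono point weighted_abs weighted_diff gibbs_weighted u v
        Bochner_Integration.integrable_add integrable_mult_right square_exp_moment integrable_V_exp_V)
  also have "\<dots> = q / partition_min * square_exp_mean + q * square_exp_mean / partition_min\<^sup>2 * (\<integral>x. V x * ?e x \<partial>P)"
    unfolding square_exp_mean_def using square_exp_moment integrable_V_exp_V by simp
  also have "\<dots> \<le> q / partition_min * square_exp_mean + q * square_exp_mean / partition_min\<^sup>2 * square_exp_mean"
    using int_V q square_exp_mean_nonneg by (intro add_left_mono mult_left_mono) auto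
  also have "\<dots> = q * (square_exp_mean / partition_min + (square_exp_mean / partition_min)\<^sup>2)" by (simp add: power2_eq_square algebra_simps)
  finally show ?thesis .
qed

text \<open>The bound tends to \<open>E[V]\<close> as \<open>\<epsilon>\<close> tends to \<open>0\<close>, which makes the moment constraint inactive for small \<open>\<epsilon>\<close>.\<close>

lemma gibbs_wnorm_le:
  assumes w: "admissible \<epsilon> w" and \<epsilon>: "0 \<le> \<epsilon>" "\<epsilon> \<le> \<theta>" "\<epsilon> * (\<integral>x. V x \<partial>P) < 1"
  shows "wnorm (gibbs w) \<le> ((\<integral>x. V x \<partial>P) + \<epsilon> * square_exp_mean) / (1 - \<epsilon> * (\<integral>x. V x \<partial>P))"
proof -
  have w': "admissible \<theta> w" using w \<epsilon> by (rule_tac admissible_mono)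
  let ?Z = "\<integral>x. exp (w x * V x) \<partial>P"
  have "(\<integral>x. V x * exp (w x * V x) \<partial>P) \<le> (\<integral>x. V x + \<epsilon> * ((V x)\<^sup>2 * exp (\<theta> * V x)) \<partial>P)"
  proof (rule integral_mono)
    fix x assume x: "x \<in> space P"
    have "\<bar>exp (w x * V x) - exp 0\<bar> \<le> \<bar>w x * V x - 0\<bar> * exp (\<theta> * V x)"
      using abs_le_D1[OF admissible_exponent[OF w' x]] V_ge1[OF x] \<theta>_pos
      by (intro exp_diff_le) (assumption, simp)
    also have "\<dots> \<le> \<epsilon> * V x * exp (\<theta> * V x)"
      using admissible_exponent[OF w x] by (intro mult_right_mono) auto
    finally have "exp (w x * V x) \<le> 1 + \<epsilon> * V x * exp (\<theta> * V x)" by simp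
    then have "V x * exp (w x * V x) \<le> V x * (1 + \<epsilon> * V x * exp (\<theta> * V x))"
      using V_ge1[OF x] by (intro mult_left_mono) auto
    then show "V x * exp (w x * V x) \<le> V x + \<epsilon> * ((V x)\<^sup>2 * exp (\<theta> * V x))"
      by (simp add: power2_eq_square algebra_simps)
  qed (use integrable_tilt(2)[OF w'] integrable_V square_exp_moment in auto)
  also have "\<dots> = (\<integral>x. V x \<partial>P) + \<epsilon> * square_exp_mean" using integrable_V square_exp_moment by (simp add: square_exp_mean_def)
  finally have num: "(\<integral>x. V x * exp (w x * V x) \<partial>P) \<le> (\<integral>x. V x \<partial>P) + \<epsilon> * square_exp_mean" .
  have "1 - \<epsilon> * (\<integral>x. V x \<partial>P) = (\<integral>x. 1 - \<epsilon> * V x \<partial>P)" using integrable_V by (simp add: prob_space)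
  also have "\<dots> \<le> ?Z"
  proof (rule integral_mono)
    fix x assume x: "x \<in> space P"
    show "1 - \<epsilon> * V x \<le> exp (w x * V x)"
      using admissible_exponent[OF w x] exp_ge_add_one_self[of "w x * V x"] by linarith
  qed (use integrable_tilt(1)[OF w'] integrable_V in auto)
  finally have den: "1 - \<epsilon> * (\<integral>x. V x \<partial>P) \<le> ?Z" .
  have "wnorm (gibbs w) = (\<integral>x. V x * exp (w x * V x) \<partial>P) / ?Z"
    using gibbs_pos[OF w', THEN less_imp_le] by (simp add: gibbs_def)
  also have "\<dots> \<le> ((\<integral>x. V x \<partial>P) + \<epsilon> * square_exp_mean) / (1 - \<epsilon> * (\<integral>x. V x \<partial>P))"
  proof (rule frac_le[OF _ num _ den])
    have "0 \<le> (\<integral>x. V x \<partial>P)" by (rule Bochner_Integration.integral_nonneg_AE) (auto intro!: AE_I2 dest: V_ge1)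
    then show "0 \<le> (\<integral>x. V x \<partial>P) + \<epsilon> * square_exp_mean" using \<epsilon> square_exp_mean_nonneg by simp
  qed (use \<epsilon> in simp)
  finally show ?thesis .
qed

text \<open>A bound for \<open>E[gibbs w exp (\<theta> V)]\<close> that is uniform in \<open>\<bar>w\<bar> \<le> \<theta>\<close>.\<close>

definition exp_mean_bound :: real where "exp_mean_bound = (\<integral>x. exp (2 * \<theta> * V x) \<partial>P) / partition_min"

lemma gibbs_exp_moment:
  assumes w: "admissible \<theta> w"
  shows "integrable P (\<lambda>x. gibbs w x * exp (\<theta> * V x))" "(\<integral>x. gibbs w x * exp (\<theta> * V x) \<partial>P) \<le> exp_mean_bound"
proof -
  note [measurable] = admissible_measurable[OF w] weighted_measurable[OF gibbs_weighted[OF w]]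
  have le: "gibbs w x * exp (\<theta> * V x) \<le> exp (2 * \<theta> * V x) / partition_min" if x: "x \<in> space P" for x
  proof -
    have "gibbs w x \<le> exp (\<theta> * V x) / partition_min" unfolding gibbs_def
      using partition_min_le[OF w] partition_min_pos admissible_exponent[OF w x] by (intro frac_le) auto
    then have "gibbs w x * exp (\<theta> * V x) \<le> exp (\<theta> * V x) / partition_min * exp (\<theta> * V x)" by (rule mult_right_mono) simp
    also have "\<dots> = exp (2 * \<theta> * V x) / partition_min" by (simp flip: exp_add)
    finally show ?thesis .
  qed
  have int: "integrable P (\<lambda>x. exp (2 * \<theta> * V x) / partition_min)" using exp_moment by simp
  show *: "integrable P (\<lambda>x. gibbs w x * exp (\<theta> * V x))"
    by (rule Bochner_Integration.integrable_bound[OF int])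
      (use le gibbs_pos[OF w, THEN less_imp_le] partition_min_pos in \<open>auto intro!: AE_I2 simp: abs_mult\<close>)
  show "(\<integral>x. gibbs w x * exp (\<theta> * V x) \<partial>P) \<le> exp_mean_bound"
    using integral_mono[OF * int le] by (simp add: exp_mean_bound_def)
qed

lemma exp_mean_bound_pos: "0 < exp_mean_bound"
proof -
  have adm: "admissible \<theta> (\<lambda>_. 0)" using \<theta>_pos by (simp add: admissible_def)
  have "gibbs (\<lambda>_. 0) x = 1" for x by (simp add: gibbs_def prob_space)
  then have "(\<integral>x. exp (\<theta> * V x) \<partial>P) \<le> exp_mean_bound" using gibbs_exp_moment(2)[OF adm] by simp
  moreover have "1 \<le> (\<integral>x. exp (\<theta> * V x) \<partial>P)"
  proof -
    have "(\<integral>x. 1 \<partial>P) \<le> (\<integral>x. exp (\<theta> * V x) \<partial>P)"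
      using \<theta>_pos by (intro integral_mono integrable_exp_V) (auto dest!: V_ge1 )
    then show ?thesis by (simp add: prob_space)
  qed
  ultimately show ?thesis by linarith
qed

section \<open>Weighted Pinsker inequality\<close>

text \<open>Half of \<open>\<kappa> \<theta>\<close>, where \<open>\<kappa>\<close> is the factor in the choice \<open>c = \<kappa> \<parallel>p - q\<parallel>\<close> of the Young
  parameter. The first bound on \<open>\<kappa>\<close> makes the second-order term absorbable, the second one ensures
  \<open>c \<le> 1\<close> when \<open>\<parallel>p - q\<parallel> \<le> 2 B\<close>.\<close>

definition strong_convexity :: "real \<Rightarrow> real" where
  "strong_convexity B = min (\<theta> / (2 * exp_mean_bound)) (1 / (2 * B)) * \<theta> / 2"

lemma strong_convexity_pos: "1 \<le> B \<Longrightarrow> 0 < strong_convexity B"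
  using \<theta>_pos exp_mean_bound_pos by (simp add: strong_convexity_def)

lemma integrable_times_V:
  assumes p: "weighted p" and w: "admissible \<theta> w"
  shows "integrable P (\<lambda>x. p x * (w x * V x))"
proof -
  note [measurable] = weighted_measurable[OF p] admissible_measurable[OF w]
  show ?thesis
  proof (rule Bochner_Integration.integrable_bound)
  show "integrable P (\<lambda>x. \<theta> * (V x * \<bar>p x\<bar>))" using weighted_abs[OF p] by simp
  show "AE x in P. norm (p x * (w x * V x)) \<le> norm (\<theta> * (V x * \<bar>p x\<bar>))"
  proof (rule AE_I2)
    fix x assume x: "x \<in> space P"
    have "\<bar>p x\<bar> * \<bar>w x * V x\<bar> \<le> \<bar>p x\<bar> * (\<theta> * V x)"
      by (intro mult_left_mono admissible_exponent[OF w x]) simp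
    then show "norm (p x * (w x * V x)) \<le> norm (\<theta> * (V x * \<bar>p x\<bar>))"
      using V_ge1[OF x] \<theta>_pos by (simp add: abs_mult mult_ac)
  qed
qed measurable
qed

lemma ln_gibbs:
  assumes w: "admissible \<theta> w"
  shows "ln (gibbs w x) = w x * V x - ln (\<integral>y. exp (w y * V y) \<partial>P)"
  using partition_pos[OF w] by (simp add: gibbs_def ln_div)

lemma integrable_gibbs_entropy:
  assumes w: "admissible \<theta> w"
  shows "integrable P (\<lambda>x. gibbs w x * ln (gibbs w x))"
  unfolding ln_gibbs[OF w] right_diff_distrib
  using integrable_times_V[OF gibbs_weighted[OF w] w] weighted_imp_integrable[OF gibbs_weighted[OF w]] by simp

text \<open>Since \<open>ln (gibbs w)\<close> is \<open>w V\<close> up to a constant and both densities have mass one, the right-hand side is the relative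
  entropy of \<open>p\<close> with respect to \<open>gibbs w\<close>. Integrate \<open>weighted_relative_entropy_Young\<close> with
  \<open>u = \<theta> V\<close> and \<open>c\<close> proportional to the distance itself: the quadratic error term is then at most half of the
  first-order term.\<close>

lemma entropy_strongly_convex_at_gibbs:
  assumes w: "admissible \<theta> w" and p: "weighted p" and p_nonneg: "AE x in P. 0 \<le> p x"
    and mass: "(\<integral>x. p x \<partial>P) = 1" and ent: "integrable P (\<lambda>x. p x * ln (p x))"
    and B: "1 \<le> B" "wnorm (\<lambda>x. p x - gibbs w x) \<le> 2 * B"
  shows "strong_convexity B * (wnorm (\<lambda>x. p x - gibbs w x))\<^sup>2
    \<le> (\<integral>x. p x * ln (p x) \<partial>P) - (\<integral>x. gibbs w x * ln (gibbs w x) \<partial>P)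
      - (\<integral>x. (p x - gibbs w x) * (w x * V x) \<partial>P)"
proof -
  let ?q = "gibbs w" and ?Z = "\<integral>x. exp (w x * V x) \<partial>P"
  let ?\<delta> = "wnorm (\<lambda>x. p x - ?q x)"
  define \<kappa> where "\<kappa> = min (\<theta> / (2 * exp_mean_bound)) (1 / (2 * B))"
  have \<kappa>: "0 < \<kappa>" "\<kappa> * exp_mean_bound \<le> \<theta> / 2" "\<kappa> * (2 * B) \<le> 1"
  proof -
    show "0 < \<kappa>" using \<theta>_pos exp_mean_bound_pos B by (simp add: \<kappa>_def)
    have "\<kappa> * exp_mean_bound \<le> \<theta> / (2 * exp_mean_bound) * exp_mean_bound" using exp_mean_bound_pos by (intro mult_right_mono) (auto simp: \<kappa>_def)
    then show "\<kappa> * exp_mean_bound \<le> \<theta> / 2" using exp_mean_bound_pos by simp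
    have "\<kappa> * (2 * B) \<le> 1 / (2 * B) * (2 * B)" using B by (intro mult_right_mono) (auto simp: \<kappa>_def)
    then show "\<kappa> * (2 * B) \<le> 1" using B by simp
  qed
  define c where "c = \<kappa> * ?\<delta>"
  have \<delta>0: "0 \<le> ?\<delta>" by (rule wnorm_nonneg)
  have c: "0 \<le> c" "c \<le> 1"
  proof -
    show "0 \<le> c" using \<kappa> \<delta>0 by (simp add: c_def)
    have "\<kappa> * ?\<delta> \<le> \<kappa> * (2 * B)" using B \<kappa> by (intro mult_left_mono) auto
    also have "\<dots> \<le> 1" by (rule \<kappa>)
    finally show "c \<le> 1" by (simp add: c_def)
  qed
  have q: "weighted ?q" by (rule gibbs_weighted[OF w])
  note ints = ent weighted_imp_integrable[OF p] weighted_imp_integrable[OF q] integrable_times_V[OF p w]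
    integrable_times_V[OF q w] gibbs_exp_moment(1)[OF w] weighted_abs[OF weighted_diff[OF p q]]
  have "c * \<theta> * ?\<delta> = (\<integral>x. c * \<theta> * (V x * \<bar>p x - ?q x\<bar>) \<partial>P)" using ints by simp
  also have "\<dots> \<le> (\<integral>x. p x * ln (p x) - (p x * (w x * V x) - p x * ln ?Z) - p x + ?q x
      + c\<^sup>2 * (?q x * exp (\<theta> * V x)) \<partial>P)"
  proof (rule integral_mono_AE)
    have Y: "c * \<theta> * (V x * \<bar>p x - ?q x\<bar>) \<le> p x * ln (p x) - (p x * (w x * V x) - p x * ln ?Z) - p x + ?q x
      + c\<^sup>2 * (?q x * exp (\<theta> * V x))" if x: "x \<in> space P" and px: "0 \<le> p x" for x
      using weighted_relative_entropy_Young[OF px gibbs_pos[OF w], of "\<theta> * V x" c x] V_ge1[OF x] \<theta>_pos c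
      unfolding ln_gibbs[OF w] by (simp add: algebra_simps)
    show "AE x in P. c * \<theta> * (V x * \<bar>p x - ?q x\<bar>) \<le> p x * ln (p x) - (p x * (w x * V x) - p x * ln ?Z) - p x + ?q x
      + c\<^sup>2 * (?q x * exp (\<theta> * V x))"
      using p_nonneg AE_space by eventually_elim (rule Y)
  qed (use ints in auto)
  also have "\<dots> = (\<integral>x. p x * ln (p x) \<partial>P) - (\<integral>x. p x * (w x * V x) \<partial>P) + ln ?Z
      + c\<^sup>2 * (\<integral>x. ?q x * exp (\<theta> * V x) \<partial>P)"
    using ints mass integral_gibbs[OF w] by simp
  also have "\<dots> \<le> (\<integral>x. p x * ln (p x) \<partial>P) - (\<integral>x. p x * (w x * V x) \<partial>P) + ln ?Z + c\<^sup>2 * exp_mean_bound"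
    by (intro add_left_mono mult_left_mono gibbs_exp_moment[OF w]) auto
  also have "ln ?Z = (\<integral>x. ?q x * (w x * V x) \<partial>P) - (\<integral>x. ?q x * ln (?q x) \<partial>P)"
    unfolding ln_gibbs[OF w] right_diff_distrib using ints integral_gibbs[OF w] by simp
  finally have main: "\<kappa> * \<theta> * ?\<delta>\<^sup>2 \<le> (\<integral>x. p x * ln (p x) \<partial>P) - (\<integral>x. ?q x * ln (?q x) \<partial>P)
      - (\<integral>x. (p x - ?q x) * (w x * V x) \<partial>P) + c\<^sup>2 * exp_mean_bound"
    unfolding left_diff_distrib using ints by (simp add: c_def power2_eq_square mult_ac)
  have "c\<^sup>2 * exp_mean_bound = \<kappa> * ?\<delta>\<^sup>2 * (\<kappa> * exp_mean_bound)" by (simp add: c_def power2_eq_square mult_ac)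
  also have "\<dots> \<le> \<kappa> * ?\<delta>\<^sup>2 * (\<theta> / 2)" using \<kappa> by (intro mult_left_mono) auto
  finally have "c\<^sup>2 * exp_mean_bound \<le> \<kappa> * \<theta> * ?\<delta>\<^sup>2 / 2" by (simp add: mult_ac)
  moreover have "strong_convexity B * ?\<delta>\<^sup>2 = \<kappa> * \<theta> * ?\<delta>\<^sup>2 / 2" by (simp add: strong_convexity_def \<kappa>_def)
  ultimately show ?thesis using main by linarith
qed

section \<open>Existence and optimality of the self-consistent density\<close>

lemma gradient_measurable:
  assumes "weighted p" shows "gradient p \<in> borel_measurable P"
  unfolding gradient_def[abs_def]
  using partial_derivative_measurable[OF _ weighted_measurable[OF assms]] by measurable

lemma gradient_bound:
  assumes x: "x \<in> space P" and p: "weighted p"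
  shows "\<bar>gradient p x\<bar> \<le> real T * (V x * wnorm p ^ (T - 1))"
proof -
  have "\<bar>gradient p x\<bar> \<le> (\<Sum>t=1..T. \<bar>partial_derivative t p x\<bar>)" unfolding gradient_def by (rule sum_abs)
  also have "\<dots> \<le> (\<Sum>t=1..T. V x * wnorm p ^ (T - 1))"
    by (intro sum_mono partial_derivative_bound x p)
  finally show ?thesis by simp
qed

lemma gradient_diff_bound:
  assumes x: "x \<in> space P" and p: "weighted p" and q: "weighted q" "\<And>y. y \<in> space P \<Longrightarrow> 0 \<le> q y"
  shows "\<bar>gradient p x - gradient q x\<bar>
    \<le> real T * (V x * ((wnorm q + wnorm (\<lambda>y. p y - q y)) ^ (T - 1) - wnorm q ^ (T - 1)))"
proof -
  have "\<bar>gradient p x - gradient q x\<bar> \<le> (\<Sum>t=1..T. \<bar>partial_derivative t p x - partial_derivative t q x\<bar>)"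
    unfolding gradient_def sum_subtractf[symmetric] by (rule sum_abs)
  also have "\<dots> \<le> (\<Sum>t=1..T. V x * ((wnorm q + wnorm (\<lambda>y. p y - q y)) ^ (T - 1) - wnorm q ^ (T - 1)))"
    by (intro sum_mono partial_derivative_diff_bound x p q)
  finally show ?thesis by simp
qed

lemma wnorm_diff_le:
  assumes p: "weighted p" and q: "weighted q"
  shows "wnorm (\<lambda>x. p x - q x) \<le> wnorm p + wnorm q"
proof -
  have "wnorm (\<lambda>x. p x - q x) \<le> (\<integral>x. V x * \<bar>p x\<bar> + V x * \<bar>q x\<bar> \<partial>P)"
  proof (rule integral_mono)
    fix x assume "x \<in> space P"
    then have "V x * \<bar>p x - q x\<bar> \<le> V x * (\<bar>p x\<bar> + \<bar>q x\<bar>)"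
      using V_ge1 by (intro mult_left_mono) force+
    then show "V x * \<bar>p x - q x\<bar> \<le> V x * \<bar>p x\<bar> + V x * \<bar>q x\<bar>" by (simp add: distrib_left)
  qed (use weighted_abs[OF p] weighted_abs[OF q] weighted_abs[OF weighted_diff[OF p q]] in auto)
  then show ?thesis using weighted_abs[OF p] weighted_abs[OF q] by simp
qed

text \<open>Apply the contraction principle to \<open>u \<mapsto> gradient (gibbs (u / \<alpha>)) / V\<close> on functions bounded by \<open>R\<close>.
  Dividing by \<open>V\<close> is what makes the gradients bounded, and the factor \<open>1 / \<alpha>\<close> in the exponent provides the contraction.\<close>

lemma gibbs_fixed_point:
  assumes B: "1 \<le> B" and \<alpha>: "0 < \<alpha>" and R: "R = real T * B ^ (T - 1)" "R / \<alpha> \<le> \<theta>"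
    and ball: "\<And>w. admissible (R / \<alpha>) w \<Longrightarrow> wnorm (gibbs w) \<le> B"
    and contr: "2 * (real T * (real (T - 1) * (square_exp_mean / partition_min + (square_exp_mean / partition_min)\<^sup>2) * (3 * B) ^ (T - 1))) \<le> \<alpha>"
  shows "\<exists>w. admissible (R / \<alpha>) w \<and> (\<forall>x\<in>space P. gradient (gibbs w) x = \<alpha> * (w x * V x))"
proof -
  define Q where "Q u = gibbs (\<lambda>y. u y / \<alpha>)" for u
  define \<Phi> where "\<Phi> u x = gradient (Q u) x / V x" for u x
  let ?S = "{u. admissible R u}" and ?C = "square_exp_mean / partition_min + (square_exp_mean / partition_min)\<^sup>2"
  have R0: "0 \<le> R" using B R by simp
  have scaled: "admissible (R / \<alpha>) (\<lambda>y. u y / \<alpha>)" if "u \<in> ?S" for u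
    using that \<alpha> by (auto simp: admissible_def divide_right_mono)
  have adm: "admissible \<theta> (\<lambda>y. u y / \<alpha>)" if "u \<in> ?S" for u
    using admissible_mono[OF scaled[OF that] R(2)] .
  have Q: "weighted (Q u)" "wnorm (Q u) \<le> B" "\<And>x. 0 \<le> Q u x" if "u \<in> ?S" for u
    using gibbs_weighted[OF adm[OF that]] ball[OF scaled[OF that]] gibbs_pos[OF adm[OF that], THEN less_imp_le]
    by (auto simp: Q_def)
  have C0: "0 \<le> ?C" using square_exp_mean_nonneg partition_min_pos by simp
  have "\<exists>u\<in>?S. \<forall>x\<in>space P. \<Phi> u x = u x"
  proof (rule sup_contraction_fixed_point)
    show "(\<lambda>_. 0) \<in> ?S" using R0 by (simp add: admissible_def)
    show "\<Phi> u \<in> ?S" if u: "u \<in> ?S" for u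
    proof -
      note [measurable] = gradient_measurable[OF Q(1)[OF u]]
      have "\<bar>\<Phi> u x\<bar> \<le> R" if x: "x \<in> space P" for x
      proof -
        have "\<bar>gradient (Q u) x\<bar> \<le> real T * (V x * wnorm (Q u) ^ (T - 1))"
          by (rule gradient_bound[OF x Q(1)[OF u]])
        also have "\<dots> \<le> real T * (V x * B ^ (T - 1))"
          using Q(2)[OF u] V_ge1[OF x] wnorm_nonneg by (intro mult_left_mono power_mono) auto
        finally show ?thesis using V_ge1[OF x] R by (simp add: \<Phi>_def field_simps)
      qed
      then show ?thesis unfolding admissible_def \<Phi>_def[abs_def] by simp
    qed
    show "\<bar>u x\<bar> \<le> R" if "u \<in> ?S" "x \<in> space P" for u x using that by (simp add: admissible_def)
    show "\<bar>\<Phi> u x - \<Phi> v x\<bar> \<le> q / 2" if u: "u \<in> ?S" and v: "v \<in> ?S"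
      and uv: "\<And>y. y \<in> space P \<Longrightarrow> \<bar>u y - v y\<bar> \<le> q" and x: "x \<in> space P" for u v q x
    proof -
      let ?d = "wnorm (\<lambda>y. Q u y - Q v y)"
      have q0: "0 \<le> q" using uv[OF x] by linarith
      have d: "?d \<le> q / \<alpha> * ?C" unfolding Q_def
        using \<alpha> uv by (intro gibbs_lipschitz adm u v) (auto simp: divide_right_mono simp flip: diff_divide_distrib)
      have d2: "?d \<le> 2 * B" using wnorm_diff_le[OF Q(1)[OF u] Q(1)[OF v]] Q(2)[OF u] Q(2)[OF v] by linarith
      have "\<bar>gradient (Q u) x - gradient (Q v) x\<bar>
          \<le> real T * (V x * ((wnorm (Q v) + ?d) ^ (T - 1) - wnorm (Q v) ^ (T - 1)))"
        by (intro gradient_diff_bound x Q u v)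
      also have "\<dots> \<le> real T * (V x * (real (T - 1) * ?d * (3 * B) ^ (T - 1)))"
        using B V_ge1[OF x] d2 Q(2)[OF v] by (intro mult_left_mono power_diff_le wnorm_nonneg) auto
      also have "\<dots> \<le> real T * (V x * (real (T - 1) * (q / \<alpha> * ?C) * (3 * B) ^ (T - 1)))"
        using d V_ge1[OF x] B by (intro mult_left_mono mult_right_mono) auto
      also have "\<dots> = V x * (q / \<alpha> * (real T * (real (T - 1) * ?C * (3 * B) ^ (T - 1))))"
        by (simp add: mult_ac)
      also have "\<dots> \<le> V x * (q / \<alpha> * (\<alpha> / 2))"
      proof (rule mult_left_mono[OF mult_left_mono])
        show "real T * (real (T - 1) * ?C * (3 * B) ^ (T - 1)) \<le> \<alpha> / 2" using contr by linarith
      qed (use V_ge1[OF x] q0 \<alpha> in auto)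
      finally have "\<bar>gradient (Q u) x - gradient (Q v) x\<bar> \<le> q / 2 * V x" using \<alpha> by (simp add: mult_ac)
      then have "\<bar>gradient (Q u) x - gradient (Q v) x\<bar> / V x \<le> q / 2"
        using V_ge1[OF x] by (subst pos_divide_le_eq) auto
      moreover have "\<Phi> u x - \<Phi> v x = (gradient (Q u) x - gradient (Q v) x) / V x"
        by (simp add: \<Phi>_def diff_divide_distrib)
      ultimately show ?thesis using V_ge1[OF x] by (simp add: abs_divide)
    qed
    show "u \<in> ?S" if f: "\<And>n. f n \<in> ?S" and lim: "\<And>x. x \<in> space P \<Longrightarrow> (\<lambda>n. f n x) \<longlonglongrightarrow> u x" for f u
    proof -
      have "u \<in> borel_measurable P"
        using f by (intro borel_measurable_LIMSEQ_real[OF lim]) (auto simp: admissible_def)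
      moreover have "\<bar>u x\<bar> \<le> R" if x: "x \<in> space P" for x
        using f x by (intro tendsto_upperbound[OF tendsto_rabs[OF lim[OF x]]]) (auto simp: admissible_def)
      ultimately show ?thesis by (simp add: admissible_def)
    qed
  qed
  then obtain u where u: "u \<in> ?S" and fp: "\<And>x. x \<in> space P \<Longrightarrow> \<Phi> u x = u x" by blast
  have "gradient (gibbs (\<lambda>y. u y / \<alpha>)) x = \<alpha> * (u x / \<alpha> * V x)" if x: "x \<in> space P" for x
    using fp[OF x] V_ge1[OF x] \<alpha> by (simp add: \<Phi>_def Q_def field_simps)
  then show ?thesis using scaled[OF u] by blast
qed

definition functional :: "real \<Rightarrow> ('a \<Rightarrow> real) \<Rightarrow> real" where
  "functional \<alpha> p = (\<integral>x. h x * (\<Prod>t=1..T. p (x t)) \<partial>iid_space P T) - \<alpha> * (\<integral>x. p x * ln (p x) \<partial>P)"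

text \<open>For \<open>B = 1 + M\<close> and \<open>V = 1 + \<Lambda>\<close> these are the feasible densities of finite entropy, the ones
  at which the objective is a real number.\<close>

definition competitor :: "real \<Rightarrow> ('a \<Rightarrow> real) \<Rightarrow> bool" where
  "competitor B p \<longleftrightarrow> weighted p \<and> (AE x in P. 0 \<le> p x) \<and> (\<integral>x. p x \<partial>P) = 1 \<and> wnorm p \<le> B
     \<and> integrable P (\<lambda>x. p x * ln (p x))"

text \<open>The fixed-point equation makes the linear term of the multilinear form equal to \<open>\<alpha>\<close> times that of the entropy, so only the
  second-order remainder and the strong convexity of the entropy survive. The extra \<open>1\<close> in the condition on \<open>\<alpha>\<close> leaves
  a full squared distance, which yields uniqueness.\<close>

lemma functional_gap:
  assumes w: "admissible \<theta> w" and fixed: "\<And>x. x \<in> space P \<Longrightarrow> gradient (gibbs w) x = \<alpha> * (w x * V x)"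
    and B: "1 \<le> B" "wnorm (gibbs w) \<le> B"
    and \<alpha>: "0 < \<alpha>" "(real T)\<^sup>2 * (3 * B) ^ T + 1 \<le> \<alpha> * strong_convexity B"
    and p: "competitor B p"
  shows "functional \<alpha> p + (wnorm (\<lambda>x. p x - gibbs w x))\<^sup>2 \<le> functional \<alpha> (gibbs w)"
proof -
  let ?q = "gibbs w" and ?\<delta> = "wnorm (\<lambda>x. p x - gibbs w x)"
  have q: "weighted ?q" by (rule gibbs_weighted[OF w])
  have p': "weighted p" "AE x in P. 0 \<le> p x" "(\<integral>x. p x \<partial>P) = 1" "wnorm p \<le> B" "integrable P (\<lambda>x. p x * ln (p x))"
    using p by (auto simp: competitor_def)
  have \<delta>: "?\<delta> \<le> 2 * B" using wnorm_diff_le[OF p'(1) q] p'(4) B by linarith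
  have "(\<integral>x. (p x - ?q x) * gradient ?q x \<partial>P) = (\<integral>x. \<alpha> * ((p x - ?q x) * (w x * V x)) \<partial>P)"
    by (intro Bochner_Integration.integral_cong) (auto simp: fixed)
  then have lin: "(\<integral>x. (p x - ?q x) * gradient ?q x \<partial>P) = \<alpha> * (\<integral>x. (p x - ?q x) * (w x * V x) \<partial>P)"
    by simp
  note rem = linear_remainder_bound[OF p'(1) q gibbs_pos[OF w, THEN less_imp_le] B \<delta>, unfolded lin]
  have "\<alpha> * (strong_convexity B * ?\<delta>\<^sup>2) \<le> \<alpha> * ((\<integral>x. p x * ln (p x) \<partial>P) - (\<integral>x. ?q x * ln (?q x) \<partial>P)
      - (\<integral>x. (p x - ?q x) * (w x * V x) \<partial>P))"
    using \<alpha> by (intro mult_left_mono entropy_strongly_convex_at_gibbs w p' B \<delta>) auto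
  moreover have "((real T)\<^sup>2 * (3 * B) ^ T + 1) * ?\<delta>\<^sup>2 \<le> \<alpha> * strong_convexity B * ?\<delta>\<^sup>2"
    using \<alpha> by (intro mult_right_mono) auto
  ultimately show ?thesis using rem unfolding functional_def by (simp add: algebra_simps)
qed

text \<open>At \<open>\<epsilon> = R / \<alpha>\<close> the bound of \<open>gibbs_wnorm_le\<close> tends to \<open>E[V] < B\<close>, so for large \<open>\<alpha>\<close> the Gibbs densities
  stay in the ball of radius \<open>B\<close>; the other conditions of \<open>gibbs_fixed_point\<close> and \<open>functional_gap\<close> are lower bounds on \<open>\<alpha>\<close>.\<close>

lemma eventually_maximizer:
  assumes B: "(\<integral>x. V x \<partial>P) < B"
  shows "\<forall>\<^sub>F \<alpha> in at_top. 0 < \<alpha> \<and> (\<exists>q. competitor B q \<and> (\<forall>x. 0 < q x)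
    \<and> (\<forall>x\<in>space P. q x = exp (gradient q x / \<alpha>) / (\<integral>y. exp (gradient q y / \<alpha>) \<partial>P))
    \<and> (\<forall>p. competitor B p \<longrightarrow> functional \<alpha> p + (wnorm (\<lambda>x. p x - q x))\<^sup>2 \<le> functional \<alpha> q))"
proof -
  let ?EV = "\<integral>x. V x \<partial>P"
  have "(\<integral>x. 1 \<partial>P) \<le> ?EV" by (intro integral_mono integrable_V) (auto dest: V_ge1)
  then have B1: "1 \<le> B" using B by (simp add: prob_space)
  define R where "R = real T * B ^ (T - 1)"
  have R0: "0 \<le> R" using B1 by (simp add: R_def)
  have eps: "((\<lambda>\<alpha>. R / \<alpha>) \<longlongrightarrow> 0) at_top"
    by (intro tendsto_divide_0[OF tendsto_const] filterlim_at_top_imp_at_infinity filterlim_ident)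
  have lim1: "((\<lambda>\<alpha>. R / \<alpha> * ?EV) \<longlongrightarrow> 0 * ?EV) at_top" by (intro tendsto_intros eps)
  have lim2: "((\<lambda>\<alpha>. (?EV + R / \<alpha> * square_exp_mean) / (1 - R / \<alpha> * ?EV)) \<longlongrightarrow> (?EV + 0 * square_exp_mean) / (1 - 0 * ?EV)) at_top"
    by (intro tendsto_intros eps) auto
  have "\<forall>\<^sub>F \<alpha> in at_top. (0::real) < \<alpha>" by (rule eventually_gt_at_top)
  moreover have "\<forall>\<^sub>F \<alpha> in at_top. R / \<alpha> < \<theta>" using order_tendstoD(2)[OF eps \<theta>_pos] .
  moreover have "\<forall>\<^sub>F \<alpha> in at_top. R / \<alpha> * ?EV < 1" using order_tendstoD(2)[OF lim1, of 1] by simp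
  moreover have "\<forall>\<^sub>F \<alpha> in at_top. (?EV + R / \<alpha> * square_exp_mean) / (1 - R / \<alpha> * ?EV) < B"
    using order_tendstoD(2)[OF lim2, of B] B by simp
  moreover have "\<forall>\<^sub>F \<alpha> in at_top. 2 * (real T * (real (T - 1) * (square_exp_mean / partition_min + (square_exp_mean / partition_min)\<^sup>2) * (3 * B) ^ (T - 1))) \<le> \<alpha>"
    by (rule eventually_ge_at_top)
  moreover have "\<forall>\<^sub>F \<alpha> in at_top. ((real T)\<^sup>2 * (3 * B) ^ T + 1) / strong_convexity B \<le> \<alpha>"
    by (rule eventually_ge_at_top)
  ultimately show ?thesis
  proof eventually_elim
    case (elim \<alpha>)
    have ball: "wnorm (gibbs w) \<le> B" if "admissible (R / \<alpha>) w" for w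
      using gibbs_wnorm_le[OF that] elim R0 by simp
    obtain w where w: "admissible (R / \<alpha>) w"
      and fixed: "\<And>x. x \<in> space P \<Longrightarrow> gradient (gibbs w) x = \<alpha> * (w x * V x)"
      using gibbs_fixed_point[OF B1 elim(1) R_def less_imp_le[OF elim(2)] ball elim(5)] by blast
    have w': "admissible \<theta> w" using admissible_mono[OF w less_imp_le[OF elim(2)]] .
    have comp: "competitor B (gibbs w)"
      using gibbs_weighted[OF w'] gibbs_pos[OF w', THEN less_imp_le] integral_gibbs[OF w'] ball[OF w]
        integrable_gibbs_entropy[OF w'] by (simp add: competitor_def)
    have tilt: "gradient (gibbs w) x / \<alpha> = w x * V x" if "x \<in> space P" for x
      using fixed[OF that] elim(1) by simp
    have "(\<integral>y. exp (gradient (gibbs w) y / \<alpha>) \<partial>P) = (\<integral>y. exp (w y * V y) \<partial>P)"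
      by (intro Bochner_Integration.integral_cong) (auto simp: tilt)
    then have form: "\<forall>x\<in>space P. gibbs w x = exp (gradient (gibbs w) x / \<alpha>) / (\<integral>y. exp (gradient (gibbs w) y / \<alpha>) \<partial>P)"
      by (simp add: tilt gibbs_def[of w])
    have "(real T)\<^sup>2 * (3 * B) ^ T + 1 \<le> \<alpha> * strong_convexity B"
      using elim(6) strong_convexity_pos[OF B1] by (simp add: divide_le_eq)
    then have "functional \<alpha> p + (wnorm (\<lambda>x. p x - gibbs w x))\<^sup>2 \<le> functional \<alpha> (gibbs w)" if "competitor B p" for p
      using functional_gap[OF w' fixed B1 ball[OF w] elim(1) _ that] by blast
    then show ?case using elim(1) comp gibbs_pos[OF w'] form by blast
  qed
qed

lemma wnorm_diff_zero_imp_AE_eq: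
  assumes p: "weighted p" and q: "weighted q" and 0: "wnorm (\<lambda>x. p x - q x) = 0"
  shows "AE x in P. p x = q x"
proof -
  have "AE x in P. V x * \<bar>p x - q x\<bar> = 0"
    using 0 weighted_abs[OF weighted_diff[OF p q]]
    by (subst (asm) integral_nonneg_eq_0_iff_AE) (auto intro!: AE_I2 mult_nonneg_nonneg dest: V_ge1)
  then show ?thesis using AE_space by eventually_elim (auto dest: V_ge1)
qed

lemma gradient_cong_AE:
  assumes p: "weighted p" and q: "weighted q" "\<And>y. y \<in> space P \<Longrightarrow> 0 \<le> q y"
    and eq: "AE x in P. p x = q x" and x: "x \<in> space P"
  shows "gradient p x = gradient q x"
proof -
  note [measurable] = weighted_measurable[OF p] weighted_measurable[OF q(1)]
  have "wnorm (\<lambda>y. p y - q y) = (\<integral>y. 0 \<partial>P)"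
    using eq by (intro integral_cong_AE) auto
  then show ?thesis using gradient_diff_bound[OF x p q] by simp
qed

section \<open>Conditional expectations given one coordinate\<close>

text \<open>A set in the sigma-algebra generated by the \<open>t\<close>-th coordinate is the preimage of a measurable \<open>A\<close>, so the defining
  property of the conditional expectation is \<open>integral_against_partial_derivative\<close> with the indicator of
  \<open>A\<close>. The chosen version therefore agrees with \<open>partial_derivative\<close> almost everywhere.\<close>

lemma g_component_eq_partial_derivative:
  assumes t: "t \<in> {1..T}" and p: "weighted p"
  shows "g_component P T h p t \<in> borel_measurable P"
    and "AE x in P. g_component P T h p t x = partial_derivative t p x"
proof -
  let ?W = "iid_space P T" and ?X = "\<lambda>x::nat \<Rightarrow> 'a. x t"
  let ?F = "vimage_algebra (space ?W) ?X P"
  let ?Y = "\<lambda>x. h x * (\<Prod>r\<in>{1..T} - {t}. p (x r))"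
  let ?g = "partial_derivative t p"
  note [measurable] = weighted_measurable[OF p] partial_derivative_measurable[OF t weighted_measurable[OF p]]
  interpret W: prob_space ?W by (intro prob_space_PiM prob_space_axioms)
  have X [measurable]: "?X \<in> ?W \<rightarrow>\<^sub>M P" using t by measurable
  have distr: "distr ?W P ?X = P" using t prob_space_axioms by (intro distr_PiM_component) auto
  have Xsp: "?X \<in> space ?W \<rightarrow> space P" using measurable_space[OF X] by auto
  have "subalgebra ?W ?F" unfolding subalgebra_def
    using sets_image_in_sets[OF refl X] by simp
  then have "finite_measure_subalgebra ?W ?F"
    by (intro finite_measure_subalgebra.intro finite_measure_subalgebra_axioms.intro W.finite_measure_axioms)
  then interpret F: sigma_finite_subalgebra ?W ?F by (rule finite_measure_subalgebra_is_sigma_finite)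
  have ind: "weighted (indicator A)" if [measurable]: "A \<in> sets P" for A
    using integrable_V by (auto simp: weighted_def intro!: integrable_real_mult_indicator)
  have g_int: "integrable P (\<lambda>x. k x * ?g x)" and
    g_eq: "(\<integral>x. k x * ?g x \<partial>P) = (\<integral>x. h x * (k (x t) * (\<Prod>r\<in>{1..T} - {t}. p (x r))) \<partial>?W)" if "weighted k" for k
    using integral_against_partial_derivative[OF t p that] by auto
  have Y_int: "integrable ?W ?Y"
  proof -
    have "(\<Prod>r=1..T. (if r = t then (\<lambda>_. 1) else p) (x r)) = (\<Prod>r\<in>{1..T} - {t}. p (x r))" for x
      unfolding prod_distinguished_coordinate[OF t] by simp
    then show ?thesis
      using integrable_h_prod[of "\<lambda>r. if r = t then (\<lambda>_. 1) else p"] p weighted_one by simp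
  qed
  have gX_int: "integrable ?W (\<lambda>x. ?g (x t))"
  proof (rule integrable_distr[OF X])
    show "integrable (distr ?W P ?X) ?g" unfolding distr using g_int[OF weighted_one] by simp
  qed
  have gX_F: "(\<lambda>x. ?g (x t)) \<in> borel_measurable ?F"
    using measurable_compose[OF measurable_vimage_algebra1[OF Xsp], of ?g borel] by simp
  have cond: "AE x in ?W. real_cond_exp ?W ?F ?Y x = ?g (x t)"
  proof (rule F.real_cond_exp_charact[OF _ Y_int gX_int gX_F])
    fix A assume "A \<in> sets ?F"
    then obtain A' where A: "A = ?X -` A' \<inter> space ?W" and A' [measurable]: "A' \<in> sets P"
      unfolding sets_vimage_algebra2[OF Xsp] by blast
    have "(\<integral>x\<in>A. ?Y x \<partial>?W) = (\<integral>x. h x * (indicator A' (x t) * (\<Prod>r\<in>{1..T} - {t}. p (x r))) \<partial>?W)"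
      unfolding set_lebesgue_integral_def
      by (intro Bochner_Integration.integral_cong) (auto simp: A indicator_def)
    also have "\<dots> = (\<integral>x. indicator A' x * ?g x \<partial>distr ?W P ?X)"
      unfolding distr by (rule g_eq[OF ind[OF A'], symmetric])
    also have "\<dots> = (\<integral>x. indicator A' (x t) * ?g (x t) \<partial>?W)" by (rule integral_distr[OF X]) measurable
    also have "\<dots> = (\<integral>x\<in>A. ?g (x t) \<partial>?W)"
      unfolding set_lebesgue_integral_def
      by (intro Bochner_Integration.integral_cong) (auto simp: A indicator_def)
    finally show "(\<integral>x\<in>A. ?Y x \<partial>?W) = (\<integral>x\<in>A. ?g (x t) \<partial>?W)" .
  qed
  have "\<exists>g. g \<in> borel_measurable P \<and> (AE x in ?W. g (x t) = real_cond_exp ?W ?F ?Y x)"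
    using cond by (intro exI[of _ ?g]) auto
  from someI_ex[OF this] have some: "g_component P T h p t \<in> borel_measurable P"
    "AE x in ?W. g_component P T h p t (x t) = real_cond_exp ?W ?F ?Y x"
    unfolding g_component_def cond_exp_given_def by auto
  show *: "g_component P T h p t \<in> borel_measurable P" by (rule some)
  note [measurable] = *
  from some(2) cond have "AE x in ?W. g_component P T h p t (x t) = ?g (x t)" by eventually_elim simp
  then have "AE x in distr ?W P ?X. g_component P T h p t x = ?g x"
    by (subst AE_distr_iff[OF X]) auto
  then show "AE x in P. g_component P T h p t x = ?g x" unfolding distr .
qed

lemma g_total_eq_gradient:
  assumes p: "weighted p"
  shows "g_total P T h p \<in> borel_measurable P" "AE x in P. g_total P T h p x = gradient p x"
proof -
  show "g_total P T h p \<in> borel_measurable P" unfolding g_total_def[abs_def]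
    using g_component_eq_partial_derivative(1)[OF _ p] by measurable
  have "AE x in P. \<forall>t\<in>{1..T}. g_component P T h p t x = partial_derivative t p x"
    using g_component_eq_partial_derivative(2)[OF _ p] by (intro AE_finite_allI) auto
  then show "AE x in P. g_total P T h p x = gradient p x"
    unfolding g_total_def gradient_def by eventually_elim simp
qed

end

section \<open>Extended expectations and entropy\<close>

lemma ext_expectation_integrable:
  assumes "integrable P f"
  shows "ext_expectation P f = ereal (\<integral>x. f x \<partial>P)"
proof -
  obtain "(\<integral>\<^sup>+x. ennreal (f x) \<partial>P) \<noteq> \<infinity>" "(\<integral>\<^sup>+x. ennreal (- f x) \<partial>P) \<noteq> \<infinity>"
    using assms unfolding real_integrable_def by auto
  then show ?thesis unfolding ext_expectation_def real_lebesgue_integral_def[OF assms]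
    by (cases "\<integral>\<^sup>+x. ennreal (f x) \<partial>P"; cases "\<integral>\<^sup>+x. ennreal (- f x) \<partial>P")
      (auto simp: enn2ereal_ennreal)
qed

lemma ext_expectation_not_integrable:
  assumes "f \<in> borel_measurable P" "(\<integral>\<^sup>+x. ennreal (- f x) \<partial>P) \<noteq> \<infinity>" "\<not> integrable P f"
  shows "ext_expectation P f = \<infinity>"
proof -
  have "(\<integral>\<^sup>+x. ennreal (f x) \<partial>P) = \<infinity>" using assms unfolding real_integrable_def by auto
  then show ?thesis using assms(2) unfolding ext_expectation_def
    by (cases "\<integral>\<^sup>+x. ennreal (- f x) \<partial>P") (auto simp: enn2ereal_ennreal)
qed

lemma neg_entropy_le_one: "0 \<le> x \<Longrightarrow> - (x * ln x) \<le> (1::real)"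
proof (cases "x = 0")
  case False
  assume "0 \<le> x"
  then have x: "0 < x" using False by simp
  then have "x * ln (1 / x) \<le> x * (1 / x - 1)" by (intro mult_left_mono ln_le_minus_one) auto
  then show ?thesis using x by (simp add: ln_div algebra_simps)
qed simp

context prob_space
begin

lemma negative_part_entropy_finite:
  assumes "AE x in M. 0 \<le> L x"
  shows "(\<integral>\<^sup>+x. ennreal (- (L x * ln (L x))) \<partial>M) \<noteq> \<infinity>"
proof -
  have "(\<integral>\<^sup>+x. ennreal (- (L x * ln (L x))) \<partial>M) \<le> (\<integral>\<^sup>+x. 1 \<partial>M)"
    using assms by (intro nn_integral_mono_AE, eventually_elim) (auto dest!: neg_entropy_le_one simp: ennreal_le_1 )
  also have "\<dots> = 1" by (simp add: emeasure_space_1)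
  finally show ?thesis by (auto simp: top_unique)
qed

end

section \<open>From sums of bounds to a product of weights\<close>

text \<open>The functions \<open>c i\<close> may be negative, only their joint sums are known to be nonnegative. Evaluating each \<open>c i\<close>
  where it is smallest among the points \<open>x j\<close> gives one nonnegative sum that, repeated \<open>card I - 1\<close> times, bounds
  the off-diagonal terms from below.\<close>

lemma sum_le_sum_all_evaluations:
  fixes c :: "'i \<Rightarrow> 'a \<Rightarrow> real"
  assumes I: "finite I" "I \<noteq> {}" and mem: "\<And>i. i \<in> I \<Longrightarrow> x i \<in> S"
    and nonneg: "\<And>y. (\<And>i. i \<in> I \<Longrightarrow> y i \<in> S) \<Longrightarrow> 0 \<le> (\<Sum>i\<in>I. c i (y i))"
  shows "(\<Sum>i\<in>I. c i (x i)) \<le> (\<Sum>j\<in>I. \<Sum>i\<in>I. c i (x j))"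
proof -
  define m where "m i = arg_min_on (\<lambda>j. c i (x j)) I" for i
  have m: "m i \<in> I" "k \<in> I \<Longrightarrow> c i (x (m i)) \<le> c i (x k)" for i k
    using arg_min_if_finite(1)[OF I, of "\<lambda>j. c i (x j)"] arg_min_least[OF I, of k "\<lambda>j. c i (x j)"]
    by (auto simp: m_def)
  have "0 \<le> (\<Sum>i\<in>I. c i (x (m i)))" using m mem by (intro nonneg) auto
  then have "0 \<le> real (card I - 1) * (\<Sum>i\<in>I. c i (x (m i)))" by simp
  also have "\<dots> = (\<Sum>i\<in>I. real (card (I - {i})) * c i (x (m i)))"
    using I by (simp add: sum_distrib_left)
  also have "\<dots> \<le> (\<Sum>i\<in>I. \<Sum>j\<in>I - {i}. c i (x j))"
    by (intro sum_mono sum_bounded_below m) auto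
  finally have "(\<Sum>i\<in>I. c i (x i)) \<le> (\<Sum>i\<in>I. c i (x i) + (\<Sum>j\<in>I - {i}. c i (x j)))"
    by (simp add: sum.distrib)
  also have "\<dots> = (\<Sum>i\<in>I. \<Sum>j\<in>I. c i (x j))"
    using I by (intro sum.cong refl) (simp add: sum.remove)
  also have "\<dots> = (\<Sum>j\<in>I. \<Sum>i\<in>I. c i (x j))" by (rule sum.swap)
  finally show ?thesis .
qed

lemma one_plus_sum_le_prod:
  fixes a :: "'i \<Rightarrow> real"
  assumes "finite I" "\<And>i. i \<in> I \<Longrightarrow> 0 \<le> a i"
  shows "1 + (\<Sum>i\<in>I. a i) \<le> (\<Prod>i\<in>I. 1 + a i)"
  using assms
proof (induction I rule: finite_induct)
  case (insert i I)
  have "0 \<le> (\<Sum>i\<in>I. a i)" using insert by (intro sum_nonneg) auto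
  then have "1 + (a i + (\<Sum>i\<in>I. a i)) \<le> (1 + a i) * (1 + (\<Sum>i\<in>I. a i))"
    using insert by (simp add: algebra_simps)
  also have "\<dots> \<le> (1 + a i) * (\<Prod>i\<in>I. 1 + a i)" using insert by (intro mult_left_mono) auto
  finally show ?case using insert by simp
qed simp

lemma exp_sum_le_sum_exp:
  fixes a :: "'i \<Rightarrow> real"
  assumes I: "finite I" "I \<noteq> {}" and c: "0 \<le> c"
  shows "exp (c * (\<Sum>i\<in>I. a i)) \<le> (\<Sum>i\<in>I. exp (c * real (card I) * a i))"
proof -
  define j where "j = arg_min_on (\<lambda>j. - a j) I"
  have j: "j \<in> I" "i \<in> I \<Longrightarrow> a i \<le> a j" for i
    using arg_min_if_finite(1)[OF I, of "\<lambda>j. - a j"] arg_min_least[OF I, of i "\<lambda>j. - a j"]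
    by (auto simp: j_def)
  have "c * (\<Sum>i\<in>I. a i) \<le> c * (\<Sum>i\<in>I. a j)" using j c by (intro mult_left_mono sum_mono) auto
  then have "exp (c * (\<Sum>i\<in>I. a i)) \<le> exp (c * real (card I) * a j)" by (simp add: mult_ac)
  also have "\<dots> \<le> (\<Sum>i\<in>I. exp (c * real (card I) * a i))"
    using I j by (intro member_le_sum) auto
  finally show ?thesis .
qed

theorem proposition5p1:
  fixes P\<^sub>0 :: "'a measure"
    and T :: nat
    and h :: "(nat \<Rightarrow> 'a) \<Rightarrow> real"
    and \<Lambda>\<^sub>c :: "nat \<Rightarrow> 'a \<Rightarrow> real"
    and \<Lambda> :: "'a \<Rightarrow> real"
    and M \<eta> :: real
  assumes "prob_space P\<^sub>0"
    and "2 \<le> T"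
    and "h \<in> borel_measurable (iid_space P\<^sub>0 T)"
    and "\<And>t. t \<in> {1..T} \<Longrightarrow> \<Lambda>\<^sub>c t \<in> borel_measurable P\<^sub>0"
    and "\<And>x. x \<in> space (iid_space P\<^sub>0 T) \<Longrightarrow> \<bar>h x\<bar> \<le> (\<Sum>t=1..T. \<Lambda>\<^sub>c t (x t))"
    and "\<And>t. t \<in> {1..T} \<Longrightarrow> \<forall>\<^sub>F \<theta> in nhds 0. integrable P\<^sub>0 (\<lambda>x. exp (\<theta> * \<Lambda>\<^sub>c t x))"
    and "\<Lambda> = (\<lambda>x. \<Sum>t=1..T. \<Lambda>\<^sub>c t x)"
    and "M > (\<integral>x. \<Lambda> x \<partial>P\<^sub>0)"
    and "\<eta> > 0"
  shows "\<forall>\<^sub>F \<alpha> in at_top.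
    (let optimal = is_arg_max (penalized_objective P\<^sub>0 T h \<eta> \<alpha>)
                     (\<lambda>L. L \<in> likelihood_ratios_bounded P\<^sub>0 \<Lambda> M)
     in (\<exists>L. optimal L \<and> (\<forall>L'. optimal L' \<longrightarrow> (AE x in P\<^sub>0. L' x = L x)))
      \<and> (\<forall>L. optimal L \<longrightarrow>
            (AE x in P\<^sub>0. L x = exp (g_total P\<^sub>0 T h L x / \<alpha>)
                             / (\<integral>y. exp (g_total P\<^sub>0 T h L y / \<alpha>) \<partial>P\<^sub>0))))"
proof -
  interpret prob_space P\<^sub>0 by fact
  let ?I = "{1..T}"
  have I: "finite ?I" "?I \<noteq> {}" using assms(2) by auto
  note [measurable] = assms(3,4)
  have \<Lambda>_eq: "\<Lambda> x = (\<Sum>t=1..T. \<Lambda>\<^sub>c t x)" for x using assms(7) by simp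
  have [measurable]: "\<Lambda> \<in> borel_measurable P\<^sub>0" unfolding assms(7) by measurable
  have sum_nonneg: "0 \<le> (\<Sum>t=1..T. \<Lambda>\<^sub>c t (y t))" if "\<And>t. t \<in> ?I \<Longrightarrow> y t \<in> space P\<^sub>0" for y
  proof -
    have "restrict y ?I \<in> space (iid_space P\<^sub>0 T)" using that by (auto simp: space_PiM)
    from assms(5)[OF this] show ?thesis by simp
  qed
  have \<Lambda>_nonneg: "0 \<le> \<Lambda> x" if "x \<in> space P\<^sub>0" for x
    using sum_nonneg[of "\<lambda>_. x"] that by (simp add: \<Lambda>_eq)
  define V where "V = (\<lambda>x. 1 + \<Lambda> x)"
  have h_le: "\<bar>h x\<bar> \<le> (\<Prod>t=1..T. V (x t))" if x: "x \<in> space (iid_space P\<^sub>0 T)" for x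
  proof -
    have mem: "x t \<in> space P\<^sub>0" if "t \<in> ?I" for t using x that by (auto simp: space_PiM PiE_iff)
    have "\<bar>h x\<bar> \<le> (\<Sum>t=1..T. \<Lambda>\<^sub>c t (x t))" by (rule assms(5)[OF x])
    also have "\<dots> \<le> (\<Sum>t=1..T. \<Lambda> (x t))"
      unfolding \<Lambda>_eq by (rule sum_le_sum_all_evaluations[OF I mem sum_nonneg])
    also have "\<dots> \<le> (\<Prod>t=1..T. V (x t))"
      using one_plus_sum_le_prod[of ?I "\<lambda>t. \<Lambda> (x t)"] \<Lambda>_nonneg mem by (simp add: V_def)
    finally show ?thesis .
  qed
  have "\<forall>\<^sub>F \<theta> in nhds 0. \<forall>t\<in>?I. integrable P\<^sub>0 (\<lambda>x. exp (\<theta> * \<Lambda>\<^sub>c t x))"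
    using assms(6) by (intro eventually_ball_finite) auto
  then obtain d where d: "0 < d"
    "\<And>\<theta> t. \<bar>\<theta>\<bar> < d \<Longrightarrow> t \<in> ?I \<Longrightarrow> integrable P\<^sub>0 (\<lambda>x. exp (\<theta> * \<Lambda>\<^sub>c t x))"
    unfolding eventually_nhds_metric by (auto simp: dist_real_def)
  \<comment> \<open>\<open>exp_sum_le_sum_exp\<close> costs a factor \<open>T\<close> in the exponent and the moment used is at \<open>2 * \<theta>\<close>, so \<open>4\<close>
    leaves \<open>2 * \<theta> * T = d / 2\<close>.\<close>
  define \<theta> where "\<theta> = d / (4 * real T)"
  have \<theta>: "0 < \<theta>" using d assms(2) by (simp add: \<theta>_def)
  have exp_V: "integrable P\<^sub>0 (\<lambda>x. exp (2 * \<theta> * V x))"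
  proof (rule Bochner_Integration.integrable_bound)
    have "2 * \<theta> * real T = d / 2" using assms(2) by (simp add: \<theta>_def)
    then show "integrable P\<^sub>0 (\<lambda>x. exp (2 * \<theta>) * (\<Sum>t=1..T. exp (2 * \<theta> * real T * \<Lambda>\<^sub>c t x)))"
      using d by (intro integrable_mult_right Bochner_Integration.integrable_sum) (auto simp: d(2))
    show "AE x in P\<^sub>0. norm (exp (2 * \<theta> * V x)) \<le> norm (exp (2 * \<theta>) * (\<Sum>t=1..T. exp (2 * \<theta> * real T * \<Lambda>\<^sub>c t x)))"
    proof (rule AE_I2)
      fix x
      have "exp (2 * \<theta> * V x) = exp (2 * \<theta>) * exp (2 * \<theta> * (\<Sum>t=1..T. \<Lambda>\<^sub>c t x))"
        by (simp add: V_def \<Lambda>_eq distrib_left exp_add)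
      also have "\<dots> \<le> exp (2 * \<theta>) * (\<Sum>t=1..T. exp (2 * \<theta> * real T * \<Lambda>\<^sub>c t x))"
        using exp_sum_le_sum_exp[OF I, of "2 * \<theta>" "\<lambda>t. \<Lambda>\<^sub>c t x"] \<theta> by (intro mult_left_mono) auto
      also have "\<dots> \<le> norm \<dots>" by simp
      finally show "norm (exp (2 * \<theta> * V x)) \<le> norm (exp (2 * \<theta>) * (\<Sum>t=1..T. exp (2 * \<theta> * real T * \<Lambda>\<^sub>c t x)))"
        by (simp only: real_norm_def abs_exp_cancel)
    qed
  qed (simp add: V_def)
  interpret weighted_kernel P\<^sub>0 T h V \<theta>
  proof
    show "V \<in> borel_measurable P\<^sub>0" unfolding V_def by measurable
    show "1 \<le> V x" if "x \<in> space P\<^sub>0" for x using \<Lambda>_nonneg[OF that] by (simp add: V_def)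
  qed (fact assms(2,3) h_le \<theta> exp_V)+
  have \<Lambda>_int: "integrable P\<^sub>0 \<Lambda>"
    using Bochner_Integration.integrable_diff[OF integrable_V, of "\<lambda>_. 1"] by (simp add: V_def)
  have EV: "(\<integral>x. V x \<partial>P\<^sub>0) < 1 + M" using \<Lambda>_int assms(8) by (simp add: V_def prob_space)
  let ?C = "likelihood_ratios_bounded P\<^sub>0 \<Lambda> M"
  \<comment> \<open>A nonnegative function that is not integrable has infinite extended expectation, so the bound \<open>M\<close>
    forces \<open>\<Lambda> L\<close> to be integrable; for a density the norm then exceeds \<open>E[\<Lambda> L]\<close> by one.\<close>
  have class_iff: "L \<in> ?C \<longleftrightarrow> weighted L \<and> (AE x in P\<^sub>0. 0 \<le> L x) \<and> (\<integral>x. L x \<partial>P\<^sub>0) = 1 \<and> wnorm L \<le> 1 + M" for L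
  proof (cases "integrable P\<^sub>0 L \<and> (AE x in P\<^sub>0. 0 \<le> L x) \<and> (\<integral>x. L x \<partial>P\<^sub>0) = 1")
    case True
    then have L: "integrable P\<^sub>0 L" "AE x in P\<^sub>0. 0 \<le> L x" "(\<integral>x. L x \<partial>P\<^sub>0) = 1" by auto
    have [measurable]: "L \<in> borel_measurable P\<^sub>0" using L by simp
    have w_iff: "weighted L \<longleftrightarrow> integrable P\<^sub>0 (\<lambda>x. \<Lambda> x * L x)"
    proof
      assume "weighted L"
      then have "integrable P\<^sub>0 (\<lambda>x. V x * L x - L x)" using L by (auto simp: weighted_def)
      then show "integrable P\<^sub>0 (\<lambda>x. \<Lambda> x * L x)" by (simp add: V_def algebra_simps)
    next
      assume "integrable P\<^sub>0 (\<lambda>x. \<Lambda> x * L x)"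
      then have "integrable P\<^sub>0 (\<lambda>x. V x * L x)" using L by (simp add: V_def distrib_right)
      then show "weighted L" by (simp add: weighted_def)
    qed
    have val: "wnorm L = 1 + (\<integral>x. \<Lambda> x * L x \<partial>P\<^sub>0)" if "weighted L"
    proof -
      have "wnorm L = (\<integral>x. L x + \<Lambda> x * L x \<partial>P\<^sub>0)"
        using L(2) by (intro integral_cong_AE) (auto elim!: eventually_mono simp: V_def distrib_right)
      then show ?thesis using L that w_iff by simp
    qed
    have neg: "(\<integral>\<^sup>+x. ennreal (- (\<Lambda> x * L x)) \<partial>P\<^sub>0) = 0"
    proof -
      have "AE x in P\<^sub>0. ennreal (- (\<Lambda> x * L x)) = 0"
        using L(2) AE_space by eventually_elim (simp add: \<Lambda>_nonneg ennreal_neg)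
      then show ?thesis by (subst nn_integral_0_iff_AE) auto
    qed
    show ?thesis
    proof (cases "weighted L")
      case True
      then show ?thesis using L val[OF True] ext_expectation_integrable[of P\<^sub>0 "\<lambda>x. \<Lambda> x * L x"] w_iff
        by (simp add: likelihood_ratios_bounded_def likelihood_ratios_def)
    next
      case False
      then have "ext_expectation P\<^sub>0 (\<lambda>x. \<Lambda> x * L x) = \<infinity>"
        using neg w_iff by (intro ext_expectation_not_integrable) auto
      then show ?thesis using False by (simp add: likelihood_ratios_bounded_def)
    qed
  next
    case False
    then show ?thesis using weighted_imp_integrable[of L]
      by (auto simp: likelihood_ratios_bounded_def likelihood_ratios_def)
  qed
  show ?thesis using eventually_maximizer[OF EV]
  proof eventually_elim
    case (elim \<alpha>)
    then obtain q where \<alpha>: "0 < \<alpha>" and q: "competitor (1 + M) q" "\<And>x. 0 < q x"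
      and form: "\<And>x. x \<in> space P\<^sub>0 \<Longrightarrow> q x = exp (gradient q x / \<alpha>) / (\<integral>y. exp (gradient q y / \<alpha>) \<partial>P\<^sub>0)"
      and gap: "\<And>p. competitor (1 + M) p \<Longrightarrow> functional \<alpha> p + (wnorm (\<lambda>x. p x - q x))\<^sup>2 \<le> functional \<alpha> q"
      by blast
    let ?obj = "penalized_objective P\<^sub>0 T h \<eta> \<alpha>"
    have qw: "weighted q" using q by (simp add: competitor_def)
    have obj_fin: "?obj p = ereal (functional \<alpha> p + \<alpha> * \<eta>)" if "competitor (1 + M) p" for p
      using that ext_expectation_integrable[of P\<^sub>0 "\<lambda>x. p x * ln (p x)"]
      by (simp add: penalized_objective_def functional_def competitor_def algebra_simps)
    have obj_inf: "?obj p = - \<infinity>" if "p \<in> ?C" "\<not> competitor (1 + M) p" for p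
    proof -
      have p: "weighted p" "AE x in P\<^sub>0. 0 \<le> p x" "\<not> integrable P\<^sub>0 (\<lambda>x. p x * ln (p x))"
        using that unfolding class_iff competitor_def by auto
      note [measurable] = weighted_measurable[OF p(1)]
      have "ext_expectation P\<^sub>0 (\<lambda>x. p x * ln (p x)) = \<infinity>"
        using p negative_part_entropy_finite[OF p(2)] by (intro ext_expectation_not_integrable) auto
      then show ?thesis using \<alpha> by (simp add: penalized_objective_def)
    qed
    have qC: "q \<in> ?C" using q unfolding class_iff competitor_def by simp
    let ?opt = "is_arg_max ?obj (\<lambda>L. L \<in> ?C)"
    have le: "?obj p \<le> ?obj q" if "p \<in> ?C" for p
    proof (cases "competitor (1 + M) p")
      case True
      have "functional \<alpha> p \<le> functional \<alpha> q" using gap[OF True] zero_le_power2[of "wnorm (\<lambda>x. p x - q x)"] by linarith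
      then show ?thesis using obj_fin[OF True] obj_fin[OF q(1)] by simp
    qed (use obj_inf that in simp)
    have q_opt: "?opt q" unfolding is_arg_max_def using qC le by (auto simp: not_less)
    \<comment> \<open>An optimal \<open>L\<close> has finite entropy because \<open>q\<close> does; the gap then forces distance zero from \<open>q\<close>.\<close>
    have opt_eq: "weighted L \<and> (AE x in P\<^sub>0. L x = q x)" if "?opt L" for L
    proof -
      have L: "L \<in> ?C" "?obj q \<le> ?obj L" using that qC unfolding is_arg_max_def by (auto simp: not_less)
      have comp: "competitor (1 + M) L"
        using obj_inf[OF L(1)] L(2) obj_fin[OF q(1)] by force
      have "functional \<alpha> q \<le> functional \<alpha> L" using L(2) obj_fin[OF comp] obj_fin[OF q(1)] by simp
      then have "(wnorm (\<lambda>x. L x - q x))\<^sup>2 \<le> 0" using gap[OF comp] by linarith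
      then have "wnorm (\<lambda>x. L x - q x) = 0" by simp
      then show ?thesis using wnorm_diff_zero_imp_AE_eq[OF _ qw] comp by (auto simp: competitor_def)
    qed
    have opt_form: "AE x in P\<^sub>0. L x = exp (g_total P\<^sub>0 T h L x / \<alpha>)
        / (\<integral>y. exp (g_total P\<^sub>0 T h L y / \<alpha>) \<partial>P\<^sub>0)" if "?opt L" for L
    proof -
      have L: "weighted L" "AE x in P\<^sub>0. L x = q x" using opt_eq[OF that] by auto
      note [measurable] = g_total_eq_gradient(1)[OF L(1)] gradient_measurable[OF qw]
      have g: "AE x in P\<^sub>0. g_total P\<^sub>0 T h L x = gradient q x"
        using g_total_eq_gradient(2)[OF L(1)] AE_space
        by eventually_elim (simp add: gradient_cong_AE[OF L(1) qw less_imp_le[OF q(2)] L(2)])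
      then have Z: "(\<integral>y. exp (g_total P\<^sub>0 T h L y / \<alpha>) \<partial>P\<^sub>0) = (\<integral>y. exp (gradient q y / \<alpha>) \<partial>P\<^sub>0)"
        by (intro integral_cong_AE) (auto elim!: eventually_mono)
      show ?thesis unfolding Z using g L(2) AE_space
        by eventually_elim (simp add: form[symmetric])
    qed
    show ?case unfolding Let_def using q_opt opt_eq opt_form by blast
  qed
qed

end
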